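(* Let $\alpha\in(0,1)$, $\theta=0$, $\lambda\in\mathbb{R}$, let $l\ge 1$ be an integer, and let $(\beta_n)_{n\ge1}$ be a sequence of positive numbers with $\beta_n\to\infty$ and $\beta_n/n^{1-\alpha}\to0$. Let $n,m\ge1$ and $1\le j\le n$ be integers. With $\phi_n,\tilde\phi_{l,n},\phi_m^{(n)},\phi_{l,m}^{(n)},y_n,y_{l,n}$ as defined in the context, one has $$\phi_{n}=\frac{1}{2\pi i}\int_{C}\frac{\xi^{n-1}\,d\xi}{(\xi-1)^n(1-y_{n}\xi^\alpha)},$$ $$\tilde{\phi}_{l,n}=\frac{1}{2\pi i}\int_{C}\frac{\xi^{n}\,d\xi}{(\xi-1)^{n+1}\left[1-y_{l,n}\xi^{\alpha-l}(\xi-1)^l\right]},$$ $$\phi_{m}^{(n)}=\frac{(1-y_{m})^j}{\binom{n+m-1}{m}}\,\frac{1}{2\pi i}\int_{C}\frac{\xi^{n+m-1}}{(\xi-1)^{m+1}}\,\frac{d\xi}{(1-y_{m}\xi^\alpha)^j},$$ $$\phi_{l,m}^{(n)}=\frac{m!}{(n)_{(m)}}\,\frac{1}{2\pi i}\int_{C}\frac{\xi^{n+m-1}\,d\xi}{(\xi-1)^{m+1}\left[1-y_{l,m}\xi^{\alpha-l}(\xi-1)^l\right]^j},$$ where in each formula $i$ in the prefactor $\frac{1}{2\pi i}$ is the imaginary unit and $C$ is a small counterclockwise circle centered at $\xi=1$ that encloses $\xi=1$ as the only singularity of the integrand.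
   Context: Ewens-Pitman sampling model with parameters $\alpha\in(0,1)$, $\theta>-\alpha$: let $\nu$ be a diffuse probability measure on a Polish space. The sequence $(X_i)_{i\ge1}$ satisfies $\mathbb{P}(X_1\in\cdot)=\nu(\cdot)$ and $$\mathbb{P}(X_{n+1}\in\cdot\mid X_1,\dots,X_n)=\frac{\theta+j\alpha}{\theta+n}\nu(\cdot)+\frac{1}{\theta+n}\sum_{r=1}^{j}(n_r-\alpha)\delta_{X_r^*}(\cdot),$$ where $X_1^*,\dots,X_j^*$ are the distinct values among $X_1,\dots,X_n$ and $N_n=(n_1,\dots,n_j)$ are their frequencies. $K_n$ is the number of distinct values (types) in $X_1,\dots,X_n$, and $M_{l,n}$ is the number of types with frequency $l$ in it. For an additional sample $X_{n+1},\dots,X_{n+m}$, $K_m^{(n)}$ is the number of types in it that do not appear in $X_1,\dots,X_n$, and $M_{l,m}^{(n)}$ is the number of such new types with frequency $l$ in the additional sample. Notation: $a_{(k)}=\Gamma(a+k)/\Gamma(a)$ is the rising factorial; $[x]$ is the integer part; powers $\xi^\alpha$ use the principal branch. For every index $n$, $$y_{n}=1-\exp\{-\lambda\beta_{n}^{\alpha/(1-\alpha)}/n^{\alpha}\},\qquad y_{l,n}=\frac{\alpha(1-\alpha)_{(l-1)}}{l!}\,\frac{y_{n}}{1-y_{n}},$$ and $y_m,y_{l,m}$ are the same expressions with $n$ replaced by $m$. With $\theta=0$, $$\phi_n=\mathbb{E}\exp\Big\{\lambda\frac{\beta_n^{1/(1-\alpha)}K_n}{n^\alpha\beta_n}\Big\},\qquad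 \tilde\phi_{l,n}=\sum_{i=0}^{[n/l]}y_{l,n}^i\binom{n-il+i\alpha}{n-il},$$ $$\phi_m^{(n)}=\mathbb{E}\Big[\exp\Big\{\lambda\beta_m^{1/(1-\alpha)}\frac{K_m^{(n)}}{m^\alpha\beta_m}\Big\}\,\Big|\,K_n=j,\ N_n=(n_1,\dots,n_j)\Big],$$ $$\phi_{l,m}^{(n)}=\mathbb{E}\Big[\exp\Big\{\lambda\beta_m^{1/(1-\alpha)}\frac{M_{l,m}^{(n)}}{m^\alpha\beta_m}\Big\}\,\Big|\,K_n=j,\ N_n=(n_1,\dots,n_j)\Big].$$ *)

theory Defs
  imports "HOL-Probability.Probability" "HOL-Complex_Analysis.Complex_Analysis"
begin

text \<open>
  Sequences \<^term>\<open>X\<close> of random variables are indexed from \<open>1\<close>; the value \<^term>\<open>X 0\<close> is not used.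
  The list of distinct values is in order of first appearance; \<^const>\<open>remdups\<close> keeps
  last occurrences, hence the two reversals.
\<close>

definition distinct_values :: "(nat \<Rightarrow> 'w \<Rightarrow> 'a) \<Rightarrow> nat \<Rightarrow> 'w \<Rightarrow> 'a list" where
  "distinct_values X n \<omega> = rev (remdups (rev (map (\<lambda>i. X i \<omega>) [1..<Suc n])))"

definition num_types :: "(nat \<Rightarrow> 'w \<Rightarrow> 'a) \<Rightarrow> nat \<Rightarrow> 'w \<Rightarrow> nat" where
  "num_types X n \<omega> = length (distinct_values X n \<omega>)"

definition frequencies :: "(nat \<Rightarrow> 'w \<Rightarrow> 'a) \<Rightarrow> nat \<Rightarrow> 'w \<Rightarrow> nat list" where
  "frequencies X n \<omega> = map (\<lambda>x. card {i \<in> {1..n}. X i \<omega> = x}) (distinct_values X n \<omega>)"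

definition new_types :: "(nat \<Rightarrow> 'w \<Rightarrow> 'a) \<Rightarrow> nat \<Rightarrow> nat \<Rightarrow> 'w \<Rightarrow> 'a set" where
  "new_types X n m \<omega> = (\<lambda>i. X i \<omega>) ` {n+1..n+m} - (\<lambda>i. X i \<omega>) ` {1..n}"

definition num_new_types :: "(nat \<Rightarrow> 'w \<Rightarrow> 'a) \<Rightarrow> nat \<Rightarrow> nat \<Rightarrow> 'w \<Rightarrow> nat" where
  "num_new_types X n m \<omega> = card (new_types X n m \<omega>)"

definition num_new_types_freq :: "(nat \<Rightarrow> 'w \<Rightarrow> 'a) \<Rightarrow> nat \<Rightarrow> nat \<Rightarrow> nat \<Rightarrow> 'w \<Rightarrow> nat" where
  "num_new_types_freq X l n m \<omega> =
     card {x \<in> new_types X n m \<omega>. card {i \<in> {n+1..n+m}. X i \<omega> = x} = l}"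

text \<open>The \<open>\<sigma>\<close>-algebra generated by \<open>X\<^sub>1, \<dots>, X\<^sub>n\<close>.\<close>

definition sample_algebra ::
    "'w measure \<Rightarrow> (nat \<Rightarrow> 'w \<Rightarrow> 'a::topological_space) \<Rightarrow> nat \<Rightarrow> 'w measure" where
  "sample_algebra M X n =
     vimage_algebra (space M) (\<lambda>\<omega>. \<lambda>i\<in>{1..n}. X i \<omega>) (\<Pi>\<^sub>M i\<in>{1..n}. borel)"

locale ewens_pitman = prob_space M + base: prob_space \<nu>
  for M :: "'w measure" and \<nu> :: "'a::polish_space measure" +
  fixes X :: "nat \<Rightarrow> 'w \<Rightarrow> 'a" and \<alpha> \<theta> :: real
  assumes alpha: "0 < \<alpha>" "\<alpha> < 1"
    and theta: "\<theta> > - \<alpha>"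
    and sets_base: "sets \<nu> = sets borel"
    and diffuse: "\<And>x. measure \<nu> {x} = 0"
    and measurable_X: "\<And>i. i \<ge> 1 \<Longrightarrow> X i \<in> measurable M borel"
    and distr_first: "distr M borel (X 1) = \<nu>"
    and predictive: "\<And>n A. n \<ge> 1 \<Longrightarrow> A \<in> sets borel \<Longrightarrow>
      (AE \<omega> in M. real_cond_exp M (sample_algebra M X n) (\<lambda>\<omega>. indicator A (X (n + 1) \<omega>)) \<omega> =
         (\<theta> + real (num_types X n \<omega>) * \<alpha>) / (\<theta> + real n) * measure \<nu> A
         + 1 / (\<theta> + real n) *
           (\<Sum>r<num_types X n \<omega>. (real (frequencies X n \<omega> ! r) - \<alpha>)
              * indicator A (distinct_values X n \<omega> ! r)))"

text \<open>Elementary conditional expectation given an event of positive probability.\<close>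

definition event_cond_exp :: "'w measure \<Rightarrow> ('w \<Rightarrow> real) \<Rightarrow> 'w set \<Rightarrow> real" where
  "event_cond_exp M f A = (LINT \<omega>:A|M. f \<omega>) / measure M A"

definition freq_event :: "'w measure \<Rightarrow> (nat \<Rightarrow> 'w \<Rightarrow> 'a) \<Rightarrow> nat \<Rightarrow> nat \<Rightarrow> nat list \<Rightarrow> 'w set" where
  "freq_event M X n j ns = {\<omega> \<in> space M. num_types X n \<omega> = j \<and> frequencies X n \<omega> = ns}"

definition y_seq :: "real \<Rightarrow> real \<Rightarrow> (nat \<Rightarrow> real) \<Rightarrow> nat \<Rightarrow> real" where
  "y_seq \<alpha> lam \<beta> n = 1 - exp (- (lam * \<beta> n powr (\<alpha> / (1 - \<alpha>)) / real n powr \<alpha>))"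

definition yl_seq :: "real \<Rightarrow> real \<Rightarrow> (nat \<Rightarrow> real) \<Rightarrow> nat \<Rightarrow> nat \<Rightarrow> real" where
  "yl_seq \<alpha> lam \<beta> l n = \<alpha> * pochhammer (1 - \<alpha>) (l - 1) / fact l * (y_seq \<alpha> lam \<beta> n / (1 - y_seq \<alpha> lam \<beta> n))"

definition phi :: "'w measure \<Rightarrow> (nat \<Rightarrow> 'w \<Rightarrow> 'a) \<Rightarrow> real \<Rightarrow> real \<Rightarrow> (nat \<Rightarrow> real) \<Rightarrow> nat \<Rightarrow> real" where
  "phi M X \<alpha> lam \<beta> n =
     (LINT \<omega>|M. exp (lam * (\<beta> n powr (1 / (1 - \<alpha>)) * real (num_types X n \<omega>)
                          / (real n powr \<alpha> * \<beta> n))))"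

definition phi_tilde :: "real \<Rightarrow> real \<Rightarrow> (nat \<Rightarrow> real) \<Rightarrow> nat \<Rightarrow> nat \<Rightarrow> real" where
  "phi_tilde \<alpha> lam \<beta> l n =
     (\<Sum>i\<in>{0..n div l}. yl_seq \<alpha> lam \<beta> l n ^ i *
        ((real n - real i * real l + real i * \<alpha>) gchoose (n - i * l)))"

definition phi_cond ::
    "'w measure \<Rightarrow> (nat \<Rightarrow> 'w \<Rightarrow> 'a) \<Rightarrow> real \<Rightarrow> real \<Rightarrow> (nat \<Rightarrow> real)
      \<Rightarrow> nat \<Rightarrow> nat \<Rightarrow> nat \<Rightarrow> nat list \<Rightarrow> real" where
  "phi_cond M X \<alpha> lam \<beta> n m j ns =
     event_cond_exp M
       (\<lambda>\<omega>. exp (lam * \<beta> m powr (1 / (1 - \<alpha>)) *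
                  (real (num_new_types X n m \<omega>) / (real m powr \<alpha> * \<beta> m))))
       (freq_event M X n j ns)"

definition phi_cond_freq ::
    "'w measure \<Rightarrow> (nat \<Rightarrow> 'w \<Rightarrow> 'a) \<Rightarrow> real \<Rightarrow> real \<Rightarrow> (nat \<Rightarrow> real)
      \<Rightarrow> nat \<Rightarrow> nat \<Rightarrow> nat \<Rightarrow> nat \<Rightarrow> nat list \<Rightarrow> real" where
  "phi_cond_freq M X \<alpha> lam \<beta> l n m j ns =
     event_cond_exp M
       (\<lambda>\<omega>. exp (lam * \<beta> m powr (1 / (1 - \<alpha>)) *
                  (real (num_new_types_freq X l n m \<omega>) / (real m powr \<alpha> * \<beta> m))))
       (freq_event M X n j ns)"

text \<open>
  The circle of radius \<open>r\<close> about \<open>c\<close> neither meets nor encloses a singularity of \<open>f\<close> other than \<open>c\<close>.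
  Poles and the points of the branch cut all count as singularities: division by zero yields \<open>0\<close>
  at a pole, but \<open>f\<close> is not analytic there.
\<close>

definition only_singularity :: "(complex \<Rightarrow> complex) \<Rightarrow> complex \<Rightarrow> real \<Rightarrow> bool" where
  "only_singularity f c r \<longleftrightarrow> 0 < r \<and> f analytic_on (cball c r - {c})"

end

theory Submission
  imports Defs
begin

text \<open>
  Every expectation in the theorem depends on the sample only through its pattern of
  coincidences: label the \<open>i\<close>-th observation by the first index at which its value occurs. The
  predictive rule makes this list of labels a Markov chain. With \<open>\<theta> = 0\<close> and given \<open>N\<close> observations with \<open>J\<close>
  distinct labels, a label seen \<open>c\<close> times is repeated with probability \<open>(c - \<alpha>) / N\<close>, and a new
  label appears with probability \<open>J \<alpha> / N\<close>
  (\<open>prob_pattern_event_old\<close>, \<open>prob_pattern_event_new\<close>). The rule is stated for fixed Borel sets,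
  whereas a repetition is the event that the next value equals an earlier random one. It is
  therefore extended from rectangles to the diagonal of the product space; the diffuse part of
  the rule does not charge the diagonal.

  Give each new type the weight \<open>w\<^sub>i\<close> if it ends up with frequency \<open>i\<close>. The expectation
  of the product of all the weights is determined by conditioning on the next observation. This
  recursion is the coefficient form of a differential equation, whose solution is the product of
  \<open>(1 - \<alpha> B(s))\<^bsup>-J\<^esup>\<close> and one factor for each label (\<open>fps_deriv_pattern_fps\<close>), where
  \<open>B(s) = \<Sum>i\<ge>1. (1 - \<alpha>)\<^bsub>(i-1)\<^esub> w\<^sub>i s\<^bsup>i\<^esup> / i!\<close>. Starting from \<open>n\<close> observations with
  \<open>j\<close> types, this gives (\<open>expected_after_new_types\<close>)
  \<open>E = m! / n\<^bsub>(m)\<^esub> [s\<^bsup>m\<^esup>] (1 - s)\<^bsup>j\<alpha> - n\<^esup> (1 - \<alpha> B(s))\<^bsup>-j\<^esup>\<close>.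
  Two choices of weights are needed, with \<open>z\<close> the exponential of the coefficient of the count in
  the exponent. If \<open>w\<close> is constantly \<open>z\<close>, then \<open>1 - \<alpha> B(s) = z ((1 - s)\<^bsup>\<alpha>\<^esup> - y)\<close>, since
  \<open>y = 1 - 1 / z\<close>. If \<open>w\<^sub>l = z\<close> and all the other weights are \<open>1\<close>, then
  \<open>1 - \<alpha> B(s) = (1 - s)\<^bsup>\<alpha>\<^esup> - y\<^sub>l s\<^bsup>l\<^esup>\<close>.

  The contour integrals are residues at \<open>\<xi> = 1\<close>, that is, coefficients of series in \<open>x = \<xi> - 1\<close>.
  The substitution \<open>x = s / (1 - s)\<close>, for which \<open>1 + x = 1 / (1 - s)\<close>, connects the two kinds of
  coefficients: \<open>[x\<^bsup>m\<^esup>] (1 + x)\<^bsup>n+m-1\<^esup> G(x) = [s\<^bsup>m\<^esup>] (1 - s)\<^bsup>-n\<^esup> G(s / (1 - s))\<close>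
  (\<open>fps_nth_change_of_variable\<close>). This gives the two conditional formulas. The formula for \<open>\<phi>\<^sub>n\<close>
  follows in the same way by letting the chain run \<open>n - 1\<close> steps from its first observation, and
  the one for \<open>\<phi>\<close> with a tilde by expanding a geometric series.
\<close>

section \<open>Rising factorial series and the change of variable\<close>

abbreviation moebius_fps :: "'a::field_char_0 fps" where
  "moebius_fps \<equiv> fps_X * inverse (1 - fps_X)"

text \<open>
  The series of \<open>(1 - s)\<^bsup>-a\<^esup>\<close>. Defining it as \<open>(1 + x)\<^bsup>a\<^esup>\<close> at \<open>x = s / (1 - s)\<close>, rather than by its
  coefficients (\<open>rising_fps_nth\<close>), lets it inherit the exponent law and makes the change of variable
  in binomial series hold by definition.
\<close>

definition rising_fps :: "'a::field_char_0 \<Rightarrow> 'a fps" where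
  "rising_fps a = fps_binomial a oo moebius_fps"

lemma moebius_fps_0: "fps_nth moebius_fps 0 = 0"
  by simp

lemma rising_fps_add: "rising_fps (a + b) = rising_fps a * rising_fps b"
  by (simp add: rising_fps_def fps_binomial_add_mult fps_compose_mult_distrib moebius_fps_0)

lemma rising_fps_0 [simp]: "rising_fps 0 = 1"
  by (simp add: rising_fps_def)

lemma rising_fps_nth_0 [simp]: "fps_nth (rising_fps a) 0 = 1"
  by (simp add: rising_fps_def)

lemma rising_fps_1: "rising_fps 1 = inverse (1 - fps_X)"
proof -
  have "(1 - fps_X) * inverse (1 - fps_X :: 'a fps) = 1"
    by (rule inverse_mult_eq_1') simp
  then have "1 + moebius_fps = inverse (1 - fps_X :: 'a fps)"
    by (simp add: algebra_simps)
  then show ?thesis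
    by (simp add: rising_fps_def fps_binomial_1 fps_compose_add_distrib)
qed

lemma rising_fps_power: "rising_fps a ^ n = rising_fps (of_nat n * a)"
  by (induction n) (simp_all add: rising_fps_add ring_distribs)

lemma moebius_fps_power: "moebius_fps ^ k = fps_X ^ k * rising_fps (of_nat k)"
  using rising_fps_power[of 1 k] by (simp add: power_mult_distrib flip: rising_fps_1)

lemma fps_deriv_rising_fps: "fps_deriv (rising_fps a) = fps_const a * rising_fps (a + 1)"
proof -
  have 1: "fps_deriv (fps_binomial a) = fps_const a * fps_binomial (a - 1)"
    using fps_binomial_add_mult[of a "-1"]
    by (simp add: fps_binomial_deriv fps_binomial_minus_one fps_divide_unit mult.assoc)
  have "fps_deriv (rising_fps a) = (fps_deriv (fps_binomial a) oo moebius_fps) * fps_deriv moebius_fps"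
    unfolding rising_fps_def by (rule fps_compose_deriv) simp
  also have "fps_deriv (fps_binomial a) oo moebius_fps = fps_const a * rising_fps (a - 1)"
    by (simp add: 1 rising_fps_def fps_compose_mult_distrib)
  also have "fps_deriv moebius_fps = (rising_fps 2 :: 'a fps)"
  proof -
    have "(1 - fps_X) * inverse (1 - fps_X :: 'a fps) = 1"
      by (rule inverse_mult_eq_1') simp
    then have "fps_X * inverse (1 - fps_X) = inverse (1 - fps_X :: 'a fps) - 1"
      by (simp add: algebra_simps)
    then have "inverse (1 - fps_X) + fps_X * (inverse (1 - fps_X))\<^sup>2 = (inverse (1 - fps_X :: 'a fps))\<^sup>2"
      by (simp add: power2_eq_square left_diff_distrib flip: mult.assoc)
    moreover have "fps_deriv moebius_fps = inverse (1 - fps_X) + fps_X * (inverse (1 - fps_X :: 'a fps))\<^sup>2"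
      by (simp add: fps_inverse_deriv)
    moreover have "rising_fps 2 = (inverse (1 - fps_X :: 'a fps))\<^sup>2"
      using rising_fps_power[of "1 :: 'a" 2] by (simp add: rising_fps_1)
    ultimately show ?thesis by simp
  qed
  finally show ?thesis
    using rising_fps_add[of "a - 1" 2] by (simp add: mult.assoc add.commute)
qed

lemma rising_fps_nth: "fps_nth (rising_fps a) i = pochhammer a i / fact i"
proof (induction i arbitrary: a)
  case (Suc i)
  have "of_nat (Suc i) * fps_nth (rising_fps a) (Suc i) = fps_nth (fps_deriv (rising_fps a)) i"
    by simp
  also have "\<dots> = a * (pochhammer (a + 1) i / fact i)"
    by (simp add: fps_deriv_rising_fps Suc.IH)
  finally show ?case
    by (simp add: pochhammer_rec field_simps del: of_nat_Suc)
qed simp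

text \<open>
  The substitution \<open>x = s / (1 - s)\<close> in the residue of \<open>(1 + x)\<^bsup>a+m-1\<^esup> G(x) / x\<^bsup>m+1\<^esup>\<close>. Both sides are
  linear in \<open>G\<close> and involve only its first \<open>m + 1\<close> coefficients, and for \<open>G = x\<^bsup>k\<^esup>\<close> both are the same
  binomial coefficient.
\<close>

lemma fps_nth_change_of_variable:
  fixes G :: "'a::field_char_0 fps"
  shows "fps_nth (fps_binomial (a + of_nat m - 1) * G) m = fps_nth (rising_fps a * (G oo moebius_fps)) m"
proof -
  have trunc: "fps_nth (F * (G oo moebius_fps)) m =
      (\<Sum>k\<le>m. fps_nth G k * fps_nth (F * moebius_fps ^ k) m)" for F :: "'a fps"
  proof -
    have ext: "fps_nth (G oo moebius_fps) i = (\<Sum>k\<le>m. fps_nth G k * fps_nth (moebius_fps ^ k) i)" if "i \<le> m" for i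
      unfolding fps_compose_nth
      by (rule sum.mono_neutral_left) (use that in \<open>auto simp: moebius_fps_power fps_X_power_mult_nth\<close>)
    have "fps_nth (F * (G oo moebius_fps)) m
        = (\<Sum>i=0..m. fps_nth F i * (\<Sum>k\<le>m. fps_nth G k * fps_nth (moebius_fps ^ k) (m - i)))"
      unfolding fps_mult_nth by (intro sum.cong) (simp_all add: ext)
    also have "\<dots> = (\<Sum>k\<le>m. \<Sum>i=0..m. fps_nth F i * (fps_nth G k * fps_nth (moebius_fps ^ k) (m - i)))"
      unfolding sum_distrib_left by (rule sum.swap)
    also have "\<dots> = (\<Sum>k\<le>m. fps_nth G k * fps_nth (F * moebius_fps ^ k) m)"
      unfolding fps_mult_nth sum_distrib_left by (intro sum.cong refl) (simp add: mult_ac)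
    finally show ?thesis .
  qed
  have "fps_nth (rising_fps a * (G oo moebius_fps)) m =
      (\<Sum>k\<le>m. fps_nth G k * fps_nth (rising_fps a * moebius_fps ^ k) m)"
    by (rule trunc)
  also have "\<dots> = (\<Sum>k\<le>m. fps_nth G k * (pochhammer (a + of_nat k) (m - k) / fact (m - k)))"
  proof (intro sum.cong refl arg_cong2[of _ _ _ _ "(*)"])
    fix k assume "k \<in> {..m}"
    have "rising_fps a * moebius_fps ^ k = fps_X ^ k * rising_fps (a + of_nat k)"
      by (simp add: moebius_fps_power rising_fps_add mult_ac)
    then show "fps_nth (rising_fps a * moebius_fps ^ k) m = pochhammer (a + of_nat k) (m - k) / fact (m - k)"
      using \<open>k \<in> {..m}\<close> by (simp add: fps_X_power_mult_nth rising_fps_nth)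
  qed
  also have "\<dots> = (\<Sum>k\<le>m. fps_nth G k * ((a + of_nat m - 1) gchoose (m - k)))"
    by (intro sum.cong refl) (simp add: gbinomial_pochhammer' of_nat_diff algebra_simps)
  also have "\<dots> = fps_nth (G * fps_binomial (a + of_nat m - 1)) m"
    by (simp add: fps_mult_nth atMost_atLeast0)
  finally show ?thesis by (simp add: mult.commute)
qed

section \<open>Contour integrals as coefficients\<close>

text \<open>
  Analyticity on the closed punctured disc extends to a neighbourhood of it, and adding \<open>c\<close> to that
  neighbourhood gives an open set. So every admissible circle, not only a small one, computes the
  residue at \<open>c\<close>.
\<close>

lemma contour_integral_only_singularity:
  assumes "only_singularity f c r"
  shows "contour_integral (circlepath c r) f = 2 * pi * \<i> * residue f c"
proof -
  from assms have r: "r > 0" and an: "f analytic_on (cball c r - {c})"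
    by (auto simp: only_singularity_def)
  from an obtain T where T: "open T" "cball c r - {c} \<subseteq> T" "f holomorphic_on T"
    by (auto simp: analytic_on_holomorphic)
  have "T \<union> {c} = T \<union> ball c r"
  proof -
    have "c \<in> ball c r" using r by simp
    moreover have "ball c r - {c} \<subseteq> T" using T(2) ball_subset_cball by blast
    ultimately show ?thesis by blast
  qed
  then have op: "open (T \<union> {c})"
    using T(1) by auto
  have hol: "f holomorphic_on (T \<union> {c} - {c})"
    using T(3) by (rule holomorphic_on_subset) auto
  have "(f has_contour_integral 2 * pi * \<i> * residue f c) (circlepath c r)"
    by (rule base_residue[OF op _ r hol]) (use T(2) in auto)
  then show ?thesis
    by (rule contour_integral_unique)
qed

lemma residue_eq_fps_nth:
  fixes f :: "complex \<Rightarrow> complex"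
  assumes G: "G has_fps_expansion F"
    and f: "\<And>x. f (c + x) = G x / x ^ Suc p"
  shows "residue f c = fps_nth F p"
proof -
  have "residue f c = residue (\<lambda>x. f (c + x)) 0"
    by (rule residue_shift_0)
  also have "\<dots> = residue (\<lambda>x. G x / x ^ Suc p) 0"
    by (simp only: f)
  also have "\<dots> = fps_nth F p"
    by (rule residue_fps_expansion_over_power_at_0[OF G])
  finally show ?thesis .
qed

lemma eventually_only_singularity:
  fixes f :: "complex \<Rightarrow> complex"
  assumes G: "G has_fps_expansion F"
    and f: "\<And>x. f (c + x) = G x / x ^ p"
  shows "\<forall>\<^sub>F r in at_right 0. only_singularity f c r"
proof -
  obtain s where s: "open s" "0 \<in> s" "G holomorphic_on s"
    by (rule has_fps_expansion_imp_holomorphic[OF G])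
  obtain e where e: "e > 0" "ball 0 e \<subseteq> s"
    by (rule openE[OF s(1,2)])
  have f': "f = (\<lambda>z. G (z - c) / (z - c) ^ p)"
  proof
    show "f z = G (z - c) / (z - c) ^ p" for z
      using f[of "z - c"] by simp
  qed
  have "only_singularity f c r" if "0 < r" "r < e" for r
  proof -
    have an: "G analytic_on ball 0 e"
      using holomorphic_on_subset[OF s(3) e(2)] by (simp add: analytic_on_open)
    have "(G \<circ> (\<lambda>z. z - c)) analytic_on (cball c r - {c})"
    proof (rule analytic_on_compose_gen[OF _ an])
      show "(\<lambda>z. z - c) analytic_on (cball c r - {c})"
        by (intro analytic_intros)
      show "\<And>z. z \<in> cball c r - {c} \<Longrightarrow> z - c \<in> ball 0 e"
        using that by (simp add: dist_norm norm_minus_commute)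
    qed
    then have "(\<lambda>z. G (z - c)) analytic_on (cball c r - {c})"
      by (simp add: o_def)
    moreover have "(\<lambda>z. (z - c) ^ p) analytic_on (cball c r - {c})"
      by (intro analytic_intros)
    ultimately have "f analytic_on (cball c r - {c})"
      unfolding f' by (rule analytic_on_divide) auto
    then show ?thesis
      using that by (simp add: only_singularity_def)
  qed
  then show ?thesis
    unfolding eventually_at_right_field using e(1) by blast
qed

lemma contour_formula:
  fixes f :: "complex \<Rightarrow> complex"
  assumes G: "G has_fps_expansion F"
    and f: "\<And>x. f (c + x) = G x / x ^ Suc p"
    and v: "v = K * fps_nth F p"
  shows "(\<forall>\<^sub>F r in at_right 0. only_singularity f c r) \<and>
    (\<forall>r. only_singularity f c r \<longrightarrow>
      v = K * (1 / (2 * of_real pi * \<i>)) * contour_integral (circlepath c r) f)"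
proof (intro conjI allI impI)
  show "\<forall>\<^sub>F r in at_right 0. only_singularity f c r"
    by (rule eventually_only_singularity[OF G f])
  fix r assume "only_singularity f c r"
  then have "contour_integral (circlepath c r) f = 2 * pi * \<i> * fps_nth F p"
    by (simp only: contour_integral_only_singularity residue_eq_fps_nth[OF G f])
  then show "v = K * (1 / (2 * of_real pi * \<i>)) * contour_integral (circlepath c r) f"
    by (simp add: v field_simps)
qed

lemma contour_formula_unscaled:
  fixes f :: "complex \<Rightarrow> complex"
  assumes G: "G has_fps_expansion F"
    and f: "\<And>x. f (c + x) = G x / x ^ Suc p"
    and v: "v = fps_nth F p"
  shows "(\<forall>\<^sub>F r in at_right 0. only_singularity f c r) \<and>
    (\<forall>r. only_singularity f c r \<longrightarrow>
      v = 1 / (2 * of_real pi * \<i>) * contour_integral (circlepath c r) f)"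
  using contour_formula[OF G f, of v 1, unfolded mult_1] v by blast

lemma has_fps_expansion_power:
  fixes f :: "complex \<Rightarrow> complex"
  assumes "f has_fps_expansion F"
  shows "(\<lambda>x. f x ^ j) has_fps_expansion F ^ j"
  by (induction j) (auto intro: has_fps_expansion_mult assms)

text \<open>
  The integrands of all four representations, written in \<open>x = \<xi> - 1\<close> and multiplied by the power of
  \<open>x\<close> that removes the pole. For \<open>k = 0\<close> the denominator at \<open>x = 0\<close> is \<open>1 - y\<close>, otherwise it is \<open>1\<close>.
\<close>

lemma kernel_has_fps_expansion:
  fixes y :: complex and a :: complex
  assumes "k = 0 \<Longrightarrow> y \<noteq> 1"
  shows "(\<lambda>x. (1 + x) ^ N * (1 / (1 - y * (1 + x) powr a * x ^ k)) ^ j)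
    has_fps_expansion fps_binomial (of_nat N) * inverse (1 - fps_const y * fps_binomial a * fps_X ^ k) ^ j"
proof -
  have "(\<lambda>x. 1 - y * (1 + x) powr a * x ^ k) has_fps_expansion
      1 - fps_const y * fps_binomial a * fps_X ^ k"
    by (intro fps_expansion_intros)
  then have "(\<lambda>x. inverse (1 - y * (1 + x) powr a * x ^ k)) has_fps_expansion
      inverse (1 - fps_const y * fps_binomial a * fps_X ^ k)"
  proof (rule has_fps_expansion_inverse)
    show "fps_nth (1 - fps_const y * fps_binomial a * fps_X ^ k) 0 \<noteq> 0"
      using assms by (cases "k = 0") simp_all
  qed
  moreover have "(\<lambda>x::complex. (1 + x) ^ N) has_fps_expansion (1 + fps_X) ^ N"
    by (intro has_fps_expansion_power fps_expansion_intros)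
  ultimately show ?thesis
    unfolding fps_binomial_of_nat inverse_eq_divide[symmetric]
    by (rule has_fps_expansion_mult[OF _ has_fps_expansion_power, rotated])
qed

text \<open>
  In the geometric series of \<open>U = c (1 + x)\<^bsup>a\<^esup> x\<^bsup>l\<^esup>\<close>, the powers beyond \<open>n div l\<close> have order greater than
  \<open>n\<close>, so the sum is finite. The remainder after that power is kept in closed form to avoid an
  infinite sum of formal series.
\<close>

lemma geometric_coefficient:
  fixes c a :: "'a::field_char_0"
  assumes l: "l \<ge> 1"
  shows "fps_nth (fps_binomial b * inverse (1 - fps_const c * fps_binomial a * fps_X ^ l)) n =
    (\<Sum>i\<in>{0..n div l}. c ^ i * ((b + of_nat i * a) gchoose (n - i * l)))"
proof -
  define U where "U = fps_const c * fps_binomial a * fps_X ^ l"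
  define N where "N = n div l"
  have inv: "(1 - U) * inverse (1 - U) = 1"
    by (rule inverse_mult_eq_1') (use l in \<open>simp add: U_def\<close>)
  have "(\<Sum>i\<le>N. U ^ i) = (\<Sum>i\<le>N. U ^ i) * ((1 - U) * inverse (1 - U))"
    by (simp add: inv)
  also have "\<dots> = (1 - U ^ Suc N) * inverse (1 - U)"
    by (simp only: mult.assoc[symmetric] mult.commute[of _ "1 - U"] sum_gp_basic)
  finally have geo: "inverse (1 - U) = (\<Sum>i\<le>N. U ^ i) + U ^ Suc N * inverse (1 - U)"
    by (simp add: left_diff_distrib)
  have Ui: "U ^ i = fps_X ^ (i * l) * (fps_const (c ^ i) * fps_binomial (of_nat i * a))" for i
    by (simp add: U_def power_mult_distrib fps_const_power fps_binomial_power mult_ac flip: power_mult)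
  have "n < Suc N * l"
    using l by (simp only: N_def div_less_iff_less_mult[symmetric])
  then have tail: "fps_nth (fps_binomial b * (U ^ Suc N * inverse (1 - U))) n = 0"
  proof -
    have "fps_binomial b * (U ^ Suc N * inverse (1 - U)) = fps_X ^ (Suc N * l) *
        (fps_binomial b * (fps_const (c ^ Suc N) * fps_binomial (of_nat (Suc N) * a) * inverse (1 - U)))"
      unfolding Ui by (simp only: mult_ac)
    then show ?thesis
      using \<open>n < Suc N * l\<close> by (simp only: fps_X_power_mult_nth if_True)
  qed
  have "fps_nth (fps_binomial b * inverse (1 - U)) n = (\<Sum>i\<le>N. fps_nth (fps_binomial b * U ^ i) n)"
    by (subst geo) (simp add: distrib_left tail sum_distrib_left fps_sum_nth del: power_Suc)
  also have "\<dots> = (\<Sum>i\<le>N. c ^ i * ((b + of_nat i * a) gchoose (n - i * l)))"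
  proof (intro sum.cong refl)
    fix i assume "i \<in> {..N}"
    then have "i * l \<le> n"
      unfolding N_def using l by (simp add: less_eq_div_iff_mult_less_eq)
    moreover have "fps_binomial b * U ^ i = fps_X ^ (i * l) * (fps_const (c ^ i) * fps_binomial (b + of_nat i * a))"
      by (simp add: Ui fps_binomial_add_mult mult_ac)
    ultimately show "fps_nth (fps_binomial b * U ^ i) n = c ^ i * ((b + of_nat i * a) gchoose (n - i * l))"
      by (simp add: fps_X_power_mult_nth)
  qed
  finally show ?thesis by (simp add: U_def N_def atMost_atLeast0)
qed

section \<open>The pattern of coincidences of a sample\<close>

text \<open>
  The label of the \<open>i\<close>-th observation. The first occurrence of a value is a canonical representative of
  its type, so patterns are lists over a finite set of numbers, whatever the space of values.
\<close>

definition first_index :: "(nat \<Rightarrow> 'w \<Rightarrow> 'a) \<Rightarrow> 'w \<Rightarrow> nat \<Rightarrow> nat" where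
  "first_index X \<omega> i = (LEAST k. 1 \<le> k \<and> X k \<omega> = X i \<omega>)"

definition pattern :: "(nat \<Rightarrow> 'w \<Rightarrow> 'a) \<Rightarrow> nat \<Rightarrow> 'w \<Rightarrow> nat list" where
  "pattern X n \<omega> = map (first_index X \<omega>) [1..<Suc n]"

text \<open>
  The distinct entries in order of first appearance, by the same double reversal that defines
  \<^const>\<open>distinct_values\<close>, so that \<open>labels_map\<close> relates the two.
\<close>

definition labels :: "'b list \<Rightarrow> 'b list" where
  "labels L = rev (remdups (rev L))"

lemma set_labels [simp]: "set (labels L) = set L"
  by (simp add: labels_def)

lemma distinct_labels [simp]: "distinct (labels L)"
  by (simp add: labels_def)

lemma length_labels: "length (labels L) = card (set L)"
  using distinct_card[OF distinct_labels, of L] by simp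

lemma labels_snoc: "labels (L @ [k]) = (if k \<in> set L then labels L else labels L @ [k])"
  by (simp add: labels_def)

lemma labels_map:
  assumes "inj_on f (set L)"
  shows "labels (map f L) = map f (labels L)"
proof -
  have "remdups (map f (rev L)) = remdups (map f (remdups (rev L)))"
    by (rule remdups_map_remdups[symmetric])
  also have "\<dots> = map f (remdups (rev L))"
    using assms by (simp add: distinct_remdups_id distinct_map)
  finally show ?thesis
    by (simp add: labels_def rev_map)
qed

lemma first_index:
  assumes "1 \<le> i"
  shows first_index_ge: "1 \<le> first_index X \<omega> i"
    and X_first_index: "X (first_index X \<omega> i) \<omega> = X i \<omega>"
    and first_index_le: "first_index X \<omega> i \<le> i"
proof -
  have "1 \<le> first_index X \<omega> i \<and> X (first_index X \<omega> i) \<omega> = X i \<omega>"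
    unfolding first_index_def by (rule LeastI[of _ i]) (use assms in simp)
  then show "1 \<le> first_index X \<omega> i" "X (first_index X \<omega> i) \<omega> = X i \<omega>" by auto
  show "first_index X \<omega> i \<le> i"
    unfolding first_index_def by (rule Least_le) (use assms in simp)
qed

lemma first_index_cong: "X i \<omega> = X k \<omega> \<Longrightarrow> first_index X \<omega> i = first_index X \<omega> k"
  by (simp add: first_index_def)

text \<open>
  This form involves only finitely many comparisons of values, which is what measurability of the
  pattern needs.
\<close>

lemma first_index_eq_iff:
  assumes "1 \<le> i"
  shows "first_index X \<omega> i = k \<longleftrightarrow>
    k \<in> {1..i} \<and> X k \<omega> = X i \<omega> \<and> (\<forall>k'\<in>{1..<k}. X k' \<omega> \<noteq> X i \<omega>)"
proof
  assume k: "first_index X \<omega> i = k"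
  have "\<not> (1 \<le> k' \<and> X k' \<omega> = X i \<omega>)" if "k' < k" for k'
    using that k unfolding first_index_def by (auto dest: not_less_Least)
  then show "k \<in> {1..i} \<and> X k \<omega> = X i \<omega> \<and> (\<forall>k'\<in>{1..<k}. X k' \<omega> \<noteq> X i \<omega>)"
    using first_index[OF assms, of X \<omega>] k by auto
next
  assume *: "k \<in> {1..i} \<and> X k \<omega> = X i \<omega> \<and> (\<forall>k'\<in>{1..<k}. X k' \<omega> \<noteq> X i \<omega>)"
  show "first_index X \<omega> i = k"
    unfolding first_index_def
  proof (rule Least_equality)
    show "1 \<le> k \<and> X k \<omega> = X i \<omega>" using * by simp
    fix k' assume "1 \<le> k' \<and> X k' \<omega> = X i \<omega>"
    then show "k \<le> k'" using * by (meson atLeastLessThan_iff not_le)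
  qed
qed

lemma pattern_Suc: "pattern X (Suc n) \<omega> = pattern X n \<omega> @ [first_index X \<omega> (Suc n)]"
  by (simp add: pattern_def)

lemma length_pattern [simp]: "length (pattern X n \<omega>) = n"
  by (simp add: pattern_def)

lemma set_pattern: "set (pattern X n \<omega>) = first_index X \<omega> ` {1..n}"
  by (simp add: pattern_def atLeastLessThanSuc_atLeastAtMost del: upt_Suc)

lemma set_pattern_subset: "set (pattern X n \<omega>) \<subseteq> {1..n}"
proof -
  have "first_index X \<omega> i \<in> {1..n}" if "i \<in> {1..n}" for i
    using first_index_ge[of i X \<omega>] first_index_le[of i X \<omega>] that by auto
  then show ?thesis by (auto simp: set_pattern)
qed

lemma first_index_pattern:
  assumes "k \<in> set (pattern X n \<omega>)"
  shows "first_index X \<omega> k = k"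
  using assms by (auto simp: set_pattern intro!: first_index_cong X_first_index)

lemma first_index_eq_label_iff:
  assumes "k \<in> set (pattern X n \<omega>)" "1 \<le> i"
  shows "first_index X \<omega> i = k \<longleftrightarrow> X i \<omega> = X k \<omega>"
  using first_index_pattern[OF assms(1)] X_first_index[OF assms(2), of X \<omega>]
    first_index_cong[of X i \<omega> k] by metis

text \<open>
  Distinct labels carry distinct values. This is what allows values to be replaced by labels in all
  the counts below.
\<close>

lemma inj_on_pattern: "inj_on (\<lambda>k. X k \<omega>) (set (pattern X n \<omega>))"
  by (rule inj_onI) (metis first_index_pattern first_index_cong)

lemma map_X_pattern: "map (\<lambda>k. X k \<omega>) (pattern X n \<omega>) = map (\<lambda>i. X i \<omega>) [1..<Suc n]"
  unfolding pattern_def by (simp add: X_first_index del: upt_Suc)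

lemma distinct_values_eq: "distinct_values X n \<omega> = map (\<lambda>k. X k \<omega>) (labels (pattern X n \<omega>))"
  unfolding distinct_values_def map_X_pattern[symmetric] labels_def[symmetric]
  by (rule labels_map[OF inj_on_pattern])

lemma num_types_eq: "num_types X n \<omega> = card (set (pattern X n \<omega>))"
  by (simp add: num_types_def distinct_values_eq length_labels)

lemma count_list_map_upt:
  "count_list (map f [a..<b]) k = card {i \<in> {a..<b}. f i = k}"
proof -
  have "count_list (map f [a..<b]) k = length (filter (\<lambda>i. f i = k) [a..<b])"
    by (simp add: count_list_eq_length_filter filter_map o_def eq_commute)
  also have "\<dots> = card {i \<in> {a..<b}. f i = k}"
    by (subst distinct_card[symmetric]) auto
  finally show ?thesis .
qed

lemma count_pattern:
  assumes "k \<in> set (pattern X n' \<omega>)"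
  shows "count_list (pattern X n \<omega>) k = card {i \<in> {1..n}. X i \<omega> = X k \<omega>}"
proof -
  have "{i \<in> {1..<Suc n}. first_index X \<omega> i = k} = {i \<in> {1..n}. X i \<omega> = X k \<omega>}"
    using first_index_eq_label_iff[OF assms] by auto
  then show ?thesis
    unfolding pattern_def count_list_map_upt by simp
qed

lemma frequencies_eq:
  "frequencies X n \<omega> = map (count_list (pattern X n \<omega>)) (labels (pattern X n \<omega>))"
  by (auto simp: frequencies_def distinct_values_eq count_pattern)

text \<open>
  Turns the sum in the predictive rule, over positions in the list of distinct values, into a sum over
  labels.
\<close>

lemma sum_over_types:
  "(\<Sum>r<num_types X n \<omega>. h (frequencies X n \<omega> ! r) (distinct_values X n \<omega> ! r)) =
   (\<Sum>k\<in>set (pattern X n \<omega>). h (count_list (pattern X n \<omega>) k) (X k \<omega>))"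
proof -
  let ?L = "labels (pattern X n \<omega>)"
  have "(\<Sum>r<num_types X n \<omega>. h (frequencies X n \<omega> ! r) (distinct_values X n \<omega> ! r)) =
     (\<Sum>r<length ?L. h (count_list (pattern X n \<omega>) (?L ! r)) (X (?L ! r) \<omega>))"
    by (simp add: num_types_def distinct_values_eq frequencies_eq)
  also have "\<dots> = (\<Sum>k\<in>set ?L. h (count_list (pattern X n \<omega>) k) (X k \<omega>))"
    by (rule sum.reindex_bij_betw) (rule bij_betw_nth; simp)
  finally show ?thesis by simp
qed

lemma new_types_eq:
  "new_types X n m \<omega> = (\<lambda>k. X k \<omega>) ` {k \<in> set (pattern X (n + m) \<omega>). n < k}"
proof (intro equalityI subsetI)
  fix x assume "x \<in> new_types X n m \<omega>"
  then obtain i where i: "i \<in> {n+1..n+m}" "x = X i \<omega>" and new: "x \<notin> (\<lambda>i. X i \<omega>) ` {1..n}"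
    by (auto simp: new_types_def)
  let ?k = "first_index X \<omega> i"
  have Xk: "X ?k \<omega> = x" and k1: "1 \<le> ?k" using first_index[of i X \<omega>] i by auto
  then have "?k \<notin> {1..n}" using new by blast
  then have "n < ?k" using k1 by simp
  moreover have "?k \<in> set (pattern X (n + m) \<omega>)" using i by (auto simp: set_pattern)
  ultimately show "x \<in> (\<lambda>k. X k \<omega>) ` {k \<in> set (pattern X (n + m) \<omega>). n < k}"
    using Xk by blast
next
  fix x assume "x \<in> (\<lambda>k. X k \<omega>) ` {k \<in> set (pattern X (n + m) \<omega>). n < k}"
  then obtain k where k: "k \<in> set (pattern X (n + m) \<omega>)" "n < k" "x = X k \<omega>" by blast
  have "k \<in> {n+1..n+m}" using set_pattern_subset[of X "n+m" \<omega>] k by auto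
  moreover have "X i \<omega> \<noteq> x" if "i \<in> {1..n}" for i
  proof
    assume "X i \<omega> = x"
    then have "first_index X \<omega> i = k"
      using first_index_eq_label_iff[OF k(1)] k(3) that by auto
    then show False using first_index_le[of i X \<omega>] that k(2) by simp
  qed
  ultimately show "x \<in> new_types X n m \<omega>"
    unfolding new_types_def using k(3) by blast
qed

lemma num_new_types_eq:
  "num_new_types X n m \<omega> = card {k \<in> set (pattern X (n + m) \<omega>). n < k}"
  unfolding num_new_types_def new_types_eq
  by (rule card_image) (rule inj_on_subset[OF inj_on_pattern], auto)

text \<open>
  A value that is new after time \<open>n\<close> has no earlier occurrence, so its frequency in the additional
  sample is its frequency in the whole sample.
\<close>

lemma num_new_types_freq_eq:
  "num_new_types_freq X l n m \<omega> =
    card {k \<in> set (pattern X (n + m) \<omega>). n < k \<and> count_list (pattern X (n + m) \<omega>) k = l}"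
proof -
  let ?P = "pattern X (n + m) \<omega>"
  have card_eq: "card {i \<in> {n+1..n+m}. X i \<omega> = X k \<omega>} = count_list ?P k"
    if k: "k \<in> set ?P" "n < k" for k
  proof -
    have "X i \<omega> \<noteq> X k \<omega>" if "i \<in> {1..n}" for i
      using first_index_eq_label_iff[OF k(1), of i] first_index_le[of i X \<omega>] that k(2) by force
    then have "{i \<in> {n+1..n+m}. X i \<omega> = X k \<omega>} = {i \<in> {1..n+m}. X i \<omega> = X k \<omega>}"
      by (force simp: not_le)
    then show ?thesis by (simp add: count_pattern[OF k(1)])
  qed
  have "{x \<in> new_types X n m \<omega>. card {i \<in> {n+1..n+m}. X i \<omega> = x} = l}
     = (\<lambda>k. X k \<omega>) ` {k \<in> set ?P. n < k \<and> count_list ?P k = l}"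
    unfolding new_types_eq using card_eq by auto
  then show ?thesis
    unfolding num_new_types_freq_def
    by (simp only:) (rule card_image, rule inj_on_subset[OF inj_on_pattern], auto)
qed

section \<open>The transition law of the pattern\<close>

definition pattern_event :: "'w measure \<Rightarrow> (nat \<Rightarrow> 'w \<Rightarrow> 'a) \<Rightarrow> nat list \<Rightarrow> 'w set" where
  "pattern_event M X L = {\<omega> \<in> space M. pattern X (length L) \<omega> = L}"

lemma sets_pattern_event:
  fixes X :: "nat \<Rightarrow> 'w \<Rightarrow> 'a::polish_space"
  assumes X: "\<And>i. i \<in> {1..length L} \<Longrightarrow> X i \<in> borel_measurable F"
  shows "pattern_event F X L \<in> sets F"
proof -
  have eq: "Measurable.pred F (\<lambda>\<omega>. X k \<omega> = X i \<omega>)" if "i \<in> {1..length L}" "k \<in> {1..length L}" for i k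
  proof -
    have [measurable]: "X i \<in> borel_measurable F" "X k \<in> borel_measurable F"
      using X that by auto
    have "Measurable.pred F (\<lambda>\<omega>. dist (X k \<omega>) (X i \<omega>) = 0)" by measurable
    then show ?thesis by simp
  qed
  have first: "Measurable.pred F (\<lambda>\<omega>. first_index X \<omega> i = k)" if i: "i \<in> {1..length L}" for i k
  proof (cases "k \<in> {1..i}")
    case True
    have [measurable]: "Measurable.pred F (\<lambda>\<omega>. X k \<omega> = X i \<omega>)"
      using eq True i by auto
    have [measurable]: "Measurable.pred F (\<lambda>\<omega>. \<forall>k'\<in>{1..<k}. X k' \<omega> \<noteq> X i \<omega>)"
    proof (rule pred_intros_finite(3))
      fix k' assume "k' \<in> {1..<k}"
      then have "Measurable.pred F (\<lambda>\<omega>. X k' \<omega> = X i \<omega>)"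
        using eq True i by auto
      then show "Measurable.pred F (\<lambda>\<omega>. X k' \<omega> \<noteq> X i \<omega>)" by (rule pred_intros_logic)
    qed simp
    have "first_index X \<omega> i = k \<longleftrightarrow> X k \<omega> = X i \<omega> \<and> (\<forall>k'\<in>{1..<k}. X k' \<omega> \<noteq> X i \<omega>)" for \<omega>
      using True i by (subst first_index_eq_iff) auto
    then show ?thesis by (simp only:) measurable
  next
    case False
    then have "first_index X \<omega> i \<noteq> k" for \<omega>
      using first_index[of i X \<omega>] i by auto
    then show ?thesis by simp
  qed
  have "pattern X (length L) \<omega> = L \<longleftrightarrow> (\<forall>i\<in>{1..length L}. first_index X \<omega> i = L ! (i - 1))" for \<omega>
  proof -
    have "pattern X (length L) \<omega> = L \<longleftrightarrow> (\<forall>i<length L. first_index X \<omega> (Suc i) = L ! i)"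
      by (simp add: list_eq_iff_nth_eq) (simp add: pattern_def del: upt_Suc)
    also have "\<dots> \<longleftrightarrow> (\<forall>i\<in>{1..length L}. first_index X \<omega> i = L ! (i - 1))"
      unfolding image_Suc_lessThan[symmetric] by auto
    finally show ?thesis .
  qed
  moreover have "Measurable.pred F (\<lambda>\<omega>. \<forall>i\<in>{1..length L}. first_index X \<omega> i = L ! (i - 1))"
    by (rule pred_intros_finite(3)) (simp_all add: first del: One_nat_def)
  ultimately show ?thesis
    unfolding pattern_event_def by simp
qed

lemma pattern_event_snoc_subset: "pattern_event M X (L @ [k]) \<subseteq> pattern_event M X L"
  by (auto simp: pattern_event_def pattern_Suc)

lemma pattern_event_Union:
  "pattern_event M X L = (\<Union>k\<in>insert (Suc (length L)) (set L). pattern_event M X (L @ [k]))"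
proof (intro equalityI subsetI)
  fix \<omega> assume "\<omega> \<in> pattern_event M X L"
  then have \<omega>: "\<omega> \<in> space M" "pattern X (length L) \<omega> = L" by (auto simp: pattern_event_def)
  let ?n = "length L"
  let ?k = "first_index X \<omega> (Suc ?n)"
  have "?k \<in> insert (Suc ?n) (set L)"
  proof (cases "?k = Suc ?n")
    case False
    then have k: "?k \<in> {1..?n}"
      using first_index[of "Suc ?n" X \<omega>] by auto
    have "first_index X \<omega> ?k = ?k"
      by (rule first_index_cong) (simp add: X_first_index)
    then have "?k \<in> first_index X \<omega> ` {1..?n}"
      using k by (metis imageI)
    then show ?thesis
      using set_pattern[of X ?n \<omega>] \<omega>(2) by simp
  qed simp
  moreover have "\<omega> \<in> pattern_event M X (L @ [?k])"
    using \<omega> by (simp add: pattern_event_def pattern_Suc)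
  ultimately show "\<omega> \<in> (\<Union>k\<in>insert (Suc ?n) (set L). pattern_event M X (L @ [k]))" by blast
next
  fix \<omega> assume "\<omega> \<in> (\<Union>k\<in>insert (Suc (length L)) (set L). pattern_event M X (L @ [k]))"
  then show "\<omega> \<in> pattern_event M X L"
    using pattern_event_snoc_subset[of M X L] by blast
qed

lemma disjoint_pattern_event: "disjoint_family_on (\<lambda>k. pattern_event M X (L @ [k])) A"
  by (auto simp: disjoint_family_on_def pattern_event_def)

lemma pattern_event_old:
  assumes "k \<in> set L"
  shows "pattern_event M X (L @ [k]) = {\<omega> \<in> pattern_event M X L. X k \<omega> = X (Suc (length L)) \<omega>}"
proof -
  have "first_index X \<omega> (Suc (length L)) = k \<longleftrightarrow> X k \<omega> = X (Suc (length L)) \<omega>"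
    if "pattern X (length L) \<omega> = L" for \<omega>
    using first_index_eq_label_iff[of k X "length L" \<omega> "Suc (length L)"] assms that by auto
  then show ?thesis
    by (auto simp: pattern_event_def pattern_Suc)
qed

text \<open>
  Uniqueness of finite measures on an intersection-stable generator, for a real linear combination.
  Working with real values admits coefficients of either sign, and no sum of measures has to be
  constructed.
\<close>

lemma finite_measure_linear_combination_eqI:
  assumes Q: "finite_measure Q" and R: "\<And>i. i \<in> I \<Longrightarrow> finite_measure (R i)"
    and sets: "sets Q = sigma_sets (space Q) G" "\<And>i. i \<in> I \<Longrightarrow> sets (R i) = sets Q"
    and G: "G \<subseteq> Pow (space Q)" "Int_stable G" "space Q \<in> G"
    and eq: "\<And>A. A \<in> G \<Longrightarrow> measure Q A = (\<Sum>i\<in>I. c i * measure (R i) A)"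
    and S: "S \<in> sets Q"
  shows "measure Q S = (\<Sum>i\<in>I. c i * measure (R i) S)"
  using G(2,1) S[unfolded sets(1)]
proof (induction rule: sigma_sets_induct_disjoint)
  case (compl A)
  have A: "A \<in> sets Q" using compl(1) by (simp add: sets(1))
  have "measure (R i) (space Q - A) = measure (R i) (space Q) - measure (R i) A" if "i \<in> I" for i
    using finite_measure.finite_measure_compl[OF R[OF that], of A] A sets(2)[OF that]
      sets_eq_imp_space_eq[OF sets(2)[OF that]] by simp
  then show ?case
    using finite_measure.finite_measure_compl[OF Q A] compl(2) eq[OF G(3)]
    by (simp add: right_diff_distrib sum_subtractf)
next
  case (union A)
  have A: "range A \<subseteq> sets Q" using union(2) by (simp add: sets(1))
  have "(\<lambda>n. \<Sum>i\<in>I. c i * measure (R i) (A n)) sums (\<Sum>i\<in>I. c i * measure (R i) (\<Union>n. A n))"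
    by (intro sums_sum sums_mult finite_measure.finite_measure_UNION R union(1))
       (use A sets(2) in auto)
  moreover have "(\<lambda>n. measure Q (A n)) sums measure Q (\<Union>n. A n)"
    by (rule finite_measure.finite_measure_UNION[OF Q A union(1)])
  ultimately show ?case
    using union(3) by (simp add: sums_unique2)
qed (simp_all add: eq)

context ewens_pitman
begin

lemma subalgebra_sample_algebra: "subalgebra M (sample_algebra M X n)"
proof -
  have "(\<lambda>\<omega>. \<lambda>i\<in>{1..n}. X i \<omega>) \<in> measurable M (\<Pi>\<^sub>M i\<in>{1..n}. borel)"
    by (rule measurable_restrict) (simp add: measurable_X)
  then have "sets (sample_algebra M X n) \<subseteq> sets M"
    unfolding sample_algebra_def by (rule sets_image_in_sets[OF refl])
  then show ?thesis
    by (simp add: subalgebra_def sample_algebra_def)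
qed

lemma measurable_X_sample_algebra:
  assumes "i \<in> {1..n}"
  shows "X i \<in> borel_measurable (sample_algebra M X n)"
proof -
  have *: "(\<lambda>\<omega>. \<lambda>i\<in>{1..n}. X i \<omega>) \<in> measurable (sample_algebra M X n) (\<Pi>\<^sub>M i\<in>{1..n}. borel)"
    unfolding sample_algebra_def
    by (rule measurable_vimage_algebra1) (auto simp: space_PiM)
  have "(\<lambda>\<omega>. (\<lambda>i\<in>{1..n}. X i \<omega>) i) \<in> borel_measurable (sample_algebra M X n)"
    by (rule measurable_compose[OF * measurable_component_singleton[OF assms]])
  then show ?thesis using assms by simp
qed

lemma sets_pattern_event_M [measurable]: "pattern_event M X L \<in> sets M"
  by (rule sets_pattern_event) (simp add: measurable_X)

text \<open>
  On the event of a fixed pattern, the weights in the predictive rule are constants, so integrating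
  the rule over an observable part \<open>E\<close> of that event gives a linear combination of probabilities.
\<close>

lemma predictive_on_pattern:
  assumes n: "length L \<ge> 1" and E: "E \<in> sets (sample_algebra M X (length L))"
    and EL: "E \<subseteq> pattern_event M X L" and A: "A \<in> sets borel"
  shows "prob {\<omega> \<in> E. X (Suc (length L)) \<omega> \<in> A} =
    (\<theta> + real (card (set L)) * \<alpha>) / (\<theta> + real (length L)) * (prob E * measure \<nu> A) +
    (\<Sum>k\<in>set L. (real (count_list L k) - \<alpha>) / (\<theta> + real (length L)) * prob {\<omega> \<in> E. X k \<omega> \<in> A})"
proof (cases "E = {}")
  case False
  let ?n = "length L"
  let ?\<kappa> = "\<lambda>\<omega>. (\<theta> + real (num_types X ?n \<omega>) * \<alpha>) / (\<theta> + real ?n) * measure \<nu> A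
         + 1 / (\<theta> + real ?n) *
           (\<Sum>r<num_types X ?n \<omega>. (real (frequencies X ?n \<omega> ! r) - \<alpha>)
              * indicator A (distinct_values X ?n \<omega> ! r))"
  have labels: "\<And>k. k \<in> set L \<Longrightarrow> 1 \<le> k"
  proof -
    obtain \<omega> where "\<omega> \<in> E" using False by blast
    then have "pattern X ?n \<omega> = L"
      using EL by (auto simp: pattern_event_def)
    then have "set L \<subseteq> {1..?n}"
      using set_pattern_subset[of X ?n \<omega>] by simp
    then show "\<And>k. k \<in> set L \<Longrightarrow> 1 \<le> k" by auto
  qed
  let ?F = "sample_algebra M X ?n"
  define c0 where "c0 = (\<theta> + real (card (set L)) * \<alpha>) / (\<theta> + real ?n)"
  define c where "c k = (real (count_list L k) - \<alpha>) / (\<theta> + real ?n)" for k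
  interpret F: finite_measure_subalgebra M ?F
    by standard (rule subalgebra_sample_algebra)
  have EM [measurable]: "E \<in> sets M"
    using E subalgebra_sample_algebra[of ?n] by (auto simp: subalgebra_def)
  have [measurable]: "A \<in> sets borel" by (rule A)
  have Xn [measurable]: "X (Suc ?n) \<in> borel_measurable M" by (simp add: measurable_X)
  have meas: "{\<omega> \<in> E. X k \<omega> \<in> A} \<in> sets M" if "k \<ge> 1" for k
  proof -
    have [measurable]: "X k \<in> borel_measurable M" using that by (simp add: measurable_X)
    have "{\<omega> \<in> E. X k \<omega> \<in> A} = E \<inter> {\<omega> \<in> space M. X k \<omega> \<in> A}"
      using sets.sets_into_space[OF EM] by auto
    also have "\<dots> \<in> sets M" by measurable
    finally show ?thesis .
  qed
  have ind_int: "(LINT \<omega>:E|M. indicator A (X k \<omega>)) = prob {\<omega> \<in> E. X k \<omega> \<in> A}"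
    and ind_integrable: "set_integrable M E (\<lambda>\<omega>. indicator A (X k \<omega>) :: real)" if "k \<ge> 1" for k
  proof -
    have *: "indicator E \<omega> * indicator A (X k \<omega>) = (indicator {\<omega> \<in> E. X k \<omega> \<in> A} \<omega> :: real)" for \<omega>
      by (auto simp: indicator_def)
    show "(LINT \<omega>:E|M. indicator A (X k \<omega>)) = prob {\<omega> \<in> E. X k \<omega> \<in> A}"
      using meas[OF that] by (simp add: set_lebesgue_integral_def * Int_absorb1 sets.sets_into_space)
    show "set_integrable M E (\<lambda>\<omega>. indicator A (X k \<omega>) :: real)"
      using meas[OF that] by (simp add: set_integrable_def * integrable_indicator_iff emeasure_eq_measure)
  qed
  have "prob {\<omega> \<in> E. X (Suc ?n) \<omega> \<in> A} = (LINT \<omega>:E|M. indicator A (X (Suc ?n) \<omega>))"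
    by (simp add: ind_int)
  also have "\<dots> = (LINT \<omega>:E|M. real_cond_exp M ?F (\<lambda>\<omega>. indicator A (X (Suc ?n) \<omega>)) \<omega>)"
  proof (rule F.real_cond_exp_intA[OF _ E])
    have "(\<lambda>\<omega>. indicator A (X (Suc ?n) \<omega>) :: real) \<in> borel_measurable M" by measurable
    then show "integrable M (\<lambda>\<omega>. indicator A (X (Suc ?n) \<omega>) :: real)"
      by (rule integrable_const_bound[where B = 1, rotated]) (simp add: indicator_def)
  qed
  also have "\<dots> = (LINT \<omega>:E|M. c0 * measure \<nu> A + (\<Sum>k\<in>set L. c k * indicator A (X k \<omega>)))"
  proof (rule set_lebesgue_integral_cong_AE)
    have "X k \<in> borel_measurable M" if "k \<in> set L" for k
      using labels that by (auto simp: measurable_X)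
    then show "(\<lambda>\<omega>. c0 * measure \<nu> A + (\<Sum>k\<in>set L. c k * indicator A (X k \<omega>))) \<in> borel_measurable M"
      by (intro borel_measurable_add borel_measurable_sum borel_measurable_times
          borel_measurable_const measurable_compose[OF _ borel_measurable_indicator[OF A]])
    have "?\<kappa> \<omega> = c0 * measure \<nu> A + (\<Sum>k\<in>set L. c k * indicator A (X k \<omega>))" if "\<omega> \<in> E" for \<omega>
    proof -
      have L: "pattern X ?n \<omega> = L" using that EL by (auto simp: pattern_event_def)
      have *: "(\<Sum>r<num_types X ?n \<omega>. (real (frequencies X ?n \<omega> ! r) - \<alpha>)
              * indicator A (distinct_values X ?n \<omega> ! r)) =
          (\<Sum>k\<in>set L. (real (count_list L k) - \<alpha>) * indicator A (X k \<omega>))"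
        using sum_over_types[of "\<lambda>c x. (real c - \<alpha>) * indicator A x" X ?n \<omega>] by (simp only: L)
      show ?thesis
        unfolding * unfolding num_types_eq L c0_def c_def sum_distrib_left by simp
    qed
    with predictive[OF n A]
    show "AE \<omega> \<in> E in M. real_cond_exp M ?F (\<lambda>\<omega>. indicator A (X (Suc ?n) \<omega>)) \<omega> =
        c0 * measure \<nu> A + (\<Sum>k\<in>set L. c k * indicator A (X k \<omega>))"
      by (auto elim!: eventually_mono)
  qed (simp_all add: EM)
  also have "\<dots> = (LINT \<omega>|M. c0 * measure \<nu> A * indicator E \<omega> +
      (\<Sum>k\<in>set L. c k * indicator {\<omega> \<in> E. X k \<omega> \<in> A} \<omega>))"
    unfolding set_lebesgue_integral_def
    by (intro Bochner_Integration.integral_cong) (auto simp: indicator_def)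
  also have "\<dots> = (LINT \<omega>|M. c0 * measure \<nu> A * indicator E \<omega>) +
      (\<Sum>k\<in>set L. LINT \<omega>|M. c k * indicator {\<omega> \<in> E. X k \<omega> \<in> A} \<omega>)"
  proof -
    have int: "integrable M (\<lambda>\<omega>. c k * indicator {\<omega> \<in> E. X k \<omega> \<in> A} \<omega>)" if "k \<in> set L" for k
      using meas[OF labels[OF that]] by (intro integrable_mult_right integrable_real_indicator)
        (simp_all add: emeasure_eq_measure)
    have "integrable M (\<lambda>\<omega>. c0 * measure \<nu> A * indicator E \<omega>)"
      by (intro integrable_mult_right integrable_real_indicator) (simp_all add: emeasure_eq_measure)
    then show ?thesis
      by (simp only: Bochner_Integration.integral_add[OF _ Bochner_Integration.integrable_sum[OF int]]
          Bochner_Integration.integral_sum[OF int])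
  qed
  also have "(\<Sum>k\<in>set L. LINT \<omega>|M. c k * indicator {\<omega> \<in> E. X k \<omega> \<in> A} \<omega>) =
      (\<Sum>k\<in>set L. c k * prob {\<omega> \<in> E. X k \<omega> \<in> A})"
  proof (intro sum.cong refl)
    fix k assume "k \<in> set L"
    from meas[OF labels[OF this]]
    show "(LINT \<omega>|M. c k * indicator {\<omega> \<in> E. X k \<omega> \<in> A} \<omega>) = c k * prob {\<omega> \<in> E. X k \<omega> \<in> A}"
      by (simp only: integral_mult_right_zero Bochner_Integration.integral_indicator Int_absorb2[OF sets.sets_into_space])
  qed
  also have "(LINT \<omega>|M. c0 * measure \<nu> A * indicator E \<omega>) = c0 * (prob E * measure \<nu> A)"
    by (simp add: Int_absorb2 sets.sets_into_space)
  finally show ?thesis by (simp only: c0_def c_def)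
qed simp

text \<open>
  The probability that the next value equals the random value \<open>X k\<close>. The predictive rule gives the
  joint law of \<open>(X k, X (n + 1))\<close>, with \<open>n = length L\<close>, on rectangles, as a combination of the product of the law of \<open>X k\<close>
  with \<open>\<nu>\<close> and of the laws of \<open>(X k, X i)\<close> for the labels \<open>i\<close>. The identity extends to the diagonal,
  where the product measure vanishes because \<open>\<nu>\<close> is diffuse, and where only \<open>i = k\<close> contributes
  because different labels have different values.
\<close>

lemma prob_pattern_event_old:
  assumes n: "length L \<ge> 1" and k: "k \<in> set L"
  shows "prob (pattern_event M X (L @ [k])) =
    (real (count_list L k) - \<alpha>) / (\<theta> + real (length L)) * prob (pattern_event M X L)"
proof (cases "pattern_event M X L = {}")
  case True
  then show ?thesis using pattern_event_snoc_subset[of M X L k] by simp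
next
  case False
  let ?n = "length L"
  let ?F = "sample_algebra M X ?n"
  let ?N = "borel \<Otimes>\<^sub>M borel :: ('a \<times> 'a) measure"
  define E where "E = pattern_event M X L"
  define c0 where "c0 = (\<theta> + real (card (set L)) * \<alpha>) / (\<theta> + real ?n)"
  define c where "c i = (real (count_list L i) - \<alpha>) / (\<theta> + real ?n)" for i
  have E_events: "E \<in> sets M" by (simp add: E_def)
  have labels: "set L \<subseteq> {1..?n}"
  proof -
    obtain \<omega> where "\<omega> \<in> pattern_event M X L" using False by blast
    then have "pattern X ?n \<omega> = L" by (auto simp: pattern_event_def)
    then show ?thesis using set_pattern_subset[of X ?n \<omega>] by simp
  qed
  define ME where "ME = restrict_space M E"
  interpret ME: finite_measure ME
    unfolding ME_def by (rule finite_measure_restrict_space[OF finite_measure_axioms E_events])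
  have X_ME: "X i \<in> borel_measurable ME" if "1 \<le> i" for i
    unfolding ME_def by (rule measurable_restrict_space1) (rule measurable_X[OF that])
  have pair_ME: "(\<lambda>\<omega>. (X k \<omega>, X i \<omega>)) \<in> measurable ME ?N" if "1 \<le> i" for i
    using X_ME[OF that] X_ME[of k] k labels by auto
  have ME_measure: "measure ME A = prob A" if "A \<subseteq> E" for A
    unfolding ME_def by (rule measure_restrict_space) (use that E_events sets.sets_into_space in \<open>auto simp: Int_absorb1\<close>)
  have space_ME: "space ME = E"
    using sets.sets_into_space[OF E_events] by (auto simp: ME_def space_restrict_space)
  define J where "J i = distr ME ?N (\<lambda>\<omega>. (X k \<omega>, X i \<omega>))" for i
  define P where "P = distr ME borel (X k) \<Otimes>\<^sub>M \<nu>"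
  \<comment> \<open>Labels are positive, so the index 0 is free to stand for the diffuse component.\<close>
  define R where "R i = (if i = 0 then P else J i)" for i
  have J_finite: "finite_measure (J i)" if "1 \<le> i" for i
    unfolding J_def by (rule ME.finite_measure_distr[OF pair_ME[OF that]])
  have J_measure: "measure (J i) S = prob {\<omega> \<in> E. (X k \<omega>, X i \<omega>) \<in> S}"
    if "1 \<le> i" "S \<in> sets ?N" for i S
    unfolding J_def measure_distr[OF pair_ME[OF that(1)] that(2)]
    by (subst ME_measure) (auto simp: space_ME intro: arg_cong[where f = prob])
  interpret D: finite_measure "distr ME borel (X k)"
    by (rule ME.finite_measure_distr[OF X_ME]) (use k labels in auto)
  interpret DP: pair_sigma_finite "distr ME borel (X k)" \<nu> ..
  have sets_P: "sets P = sets ?N"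
    unfolding P_def by (rule sets_pair_measure_cong) (simp_all add: sets_base)
  have P_times: "measure P (A \<times> B) = prob {\<omega> \<in> E. X k \<omega> \<in> A} * measure \<nu> B"
    if "A \<in> sets borel" "B \<in> sets borel" for A B
  proof -
    have "measure P (A \<times> B) = measure (distr ME borel (X k)) A * measure \<nu> B"
      unfolding P_def measure_def using that
      by (subst base.emeasure_pair_measure_Times) (simp_all add: sets_base enn2real_mult)
    also have "measure (distr ME borel (X k)) A = prob {\<omega> \<in> E. X k \<omega> \<in> A}"
      using k labels that(1)
      by (subst measure_distr[OF X_ME]) (auto simp: ME_measure space_ME intro: arg_cong[where f = prob])
    finally show ?thesis .
  qed
  have P_finite: "finite_measure P"
  proof (rule finite_measureI)
    have "emeasure P (space P) = emeasure (distr ME borel (X k)) UNIV * emeasure \<nu> (space \<nu>)"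
      unfolding P_def by (simp add: space_pair_measure base.emeasure_pair_measure_Times)
    then show "emeasure P (space P) \<noteq> \<infinity>"
      by (simp add: ennreal_mult_eq_top_iff base.emeasure_space_1)
  qed
  define G where "G = {A \<times> B | A B. A \<in> sets (borel :: 'a measure) \<and> B \<in> sets (borel :: 'a measure)}"
  have joint: "measure (J (Suc ?n)) S = (\<Sum>i\<in>insert 0 (set L). (if i = 0 then c0 else c i) * measure (R i) S)"
    if S: "S \<in> sets ?N" for S
  proof (rule finite_measure_linear_combination_eqI[where G = G])
    show "finite_measure (J (Suc ?n))" by (rule J_finite) simp
    show "finite_measure (R i)" if "i \<in> insert 0 (set L)" for i
      using that labels by (auto simp: R_def P_finite intro!: J_finite)
    show "sets (J (Suc ?n)) = sigma_sets (space (J (Suc ?n))) G"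
      by (simp add: J_def sets_pair_measure space_pair_measure G_def)
    show "sets (R i) = sets (J (Suc ?n))" if "i \<in> insert 0 (set L)" for i
      by (simp add: R_def J_def sets_P)
    show "G \<subseteq> Pow (space (J (Suc ?n)))"
      by (simp add: J_def space_pair_measure)
    show "Int_stable G"
      unfolding G_def by (rule Int_stable_pair_measure_generator)
    show "space (J (Suc ?n)) \<in> G"
      unfolding G_def J_def by (auto simp: space_pair_measure intro!: exI[of _ UNIV])
    show "S \<in> sets (J (Suc ?n))" using S by (simp add: J_def)
    fix C assume "C \<in> G"
    then obtain A B where C: "C = A \<times> B" and AB: "A \<in> sets borel" "B \<in> sets borel"
      by (auto simp: G_def)
    have CN: "C \<in> sets ?N" unfolding C using AB by (rule pair_measureI)
    \<comment> \<open>A rectangle restricts the present value to an observable event E', to which the rule applies.\<close>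
    define E' where "E' = {\<omega> \<in> E. X k \<omega> \<in> A}"
    have E'_F: "E' \<in> sets ?F"
    proof -
      have EF: "E \<in> sets ?F"
      proof -
        have "pattern_event ?F X L \<in> sets ?F"
          by (rule sets_pattern_event) (rule measurable_X_sample_algebra)
        then show ?thesis
          by (simp add: E_def pattern_event_def sample_algebra_def)
      qed
      have "X k -` A \<inter> space ?F \<in> sets ?F"
        using labels k by (intro measurable_sets[OF measurable_X_sample_algebra AB(1)]) auto
      then have "E \<inter> (X k -` A \<inter> space ?F) \<in> sets ?F" by (rule sets.Int[OF EF])
      also have "E \<inter> (X k -` A \<inter> space ?F) = E'"
        using sets.sets_into_space[OF EF] by (auto simp: E'_def)
      finally show ?thesis .
    qed
    have J_C: "measure (J i) C = prob {\<omega> \<in> E'. X i \<omega> \<in> B}" if "1 \<le> i" for i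
      unfolding J_measure[OF that CN] by (rule arg_cong[where f = prob]) (auto simp: C E'_def)
    have "measure (J (Suc ?n)) C = prob {\<omega> \<in> E'. X (Suc ?n) \<omega> \<in> B}"
      by (rule J_C) simp
    also have "\<dots> = c0 * (prob E' * measure \<nu> B) + (\<Sum>i\<in>set L. c i * prob {\<omega> \<in> E'. X i \<omega> \<in> B})"
      unfolding c0_def c_def by (rule predictive_on_pattern[OF n E'_F _ AB(2)]) (auto simp: E'_def E_def)
    also have "prob E' * measure \<nu> B = measure P C"
      by (simp add: P_times[OF AB] C E'_def)
    also have "(\<Sum>i\<in>set L. c i * prob {\<omega> \<in> E'. X i \<omega> \<in> B}) =
        (\<Sum>i\<in>set L. (if i = 0 then c0 else c i) * measure (R i) C)"
      using labels by (intro sum.cong refl) (auto simp: J_C R_def)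
    finally show "measure (J (Suc ?n)) C =
        (\<Sum>i\<in>insert 0 (set L). (if i = 0 then c0 else c i) * measure (R i) C)"
      using labels by (subst sum.insert) (auto simp: R_def)
  qed
  define \<Delta> where "\<Delta> = {p :: 'a \<times> 'a. fst p = snd p}"
  have \<Delta>: "\<Delta> \<in> sets ?N"
  proof -
    have "{p \<in> space ?N. dist (fst p) (snd p) = 0} \<in> sets ?N" by measurable
    then show ?thesis by (simp add: \<Delta>_def space_pair_measure)
  qed
  have P_\<Delta>: "measure P \<Delta> = 0"
  proof -
    have "emeasure P \<Delta> = (\<integral>\<^sup>+ x. emeasure \<nu> (Pair x -` \<Delta>) \<partial>distr ME borel (X k))"
      unfolding P_def by (rule base.emeasure_pair_measure_alt) (simp only: \<Delta> sets_P[unfolded P_def])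
    also have "\<dots> = (\<integral>\<^sup>+ x. 0 \<partial>distr ME borel (X k))"
    proof (intro nn_integral_cong)
      fix x
      have "Pair x -` \<Delta> = {x}" by (auto simp: \<Delta>_def)
      then show "emeasure \<nu> (Pair x -` \<Delta>) = 0"
        by (simp add: base.emeasure_eq_measure diffuse)
    qed
    finally show ?thesis by (simp add: measure_def)
  qed
  have J_\<Delta>: "measure (J i) \<Delta> = (if i = k then prob E else 0)" if i: "i \<in> set L" for i
  proof -
    have "{\<omega> \<in> E. (X k \<omega>, X i \<omega>) \<in> \<Delta>} = (if i = k then E else {})"
    proof (cases "i = k")
      case False
      have "X k \<omega> \<noteq> X i \<omega>" if "\<omega> \<in> E" for \<omega>
      proof -
        have "pattern X ?n \<omega> = L" using that by (auto simp: E_def pattern_event_def)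
        then show ?thesis
          using inj_onD[OF inj_on_pattern[of X \<omega> ?n], of k i] i k False by auto
      qed
      then show ?thesis using False by (auto simp: \<Delta>_def)
    qed (auto simp: \<Delta>_def)
    then show ?thesis
      using i labels by (subst J_measure[OF _ \<Delta>]) auto
  qed
  have "prob (pattern_event M X (L @ [k])) = measure (J (Suc ?n)) \<Delta>"
    by (subst pattern_event_old[OF k], subst J_measure[OF _ \<Delta>]) (simp_all add: \<Delta>_def E_def)
  also have "\<dots> = (\<Sum>i\<in>set L. c i * (if i = k then prob E else 0))"
  proof -
    have "0 \<notin> set L" using labels by auto
    then have "measure (J (Suc ?n)) \<Delta> = (\<Sum>i\<in>set L. (if i = 0 then c0 else c i) * measure (R i) \<Delta>)"
      unfolding joint[OF \<Delta>] by (subst sum.insert) (simp_all add: R_def P_\<Delta>)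
    also have "\<dots> = (\<Sum>i\<in>set L. c i * (if i = k then prob E else 0))"
      using \<open>0 \<notin> set L\<close> by (intro sum.cong refl) (auto simp: R_def J_\<Delta>)
    finally show ?thesis .
  qed
  also have "\<dots> = c k * prob E"
    using k by (simp add: if_distrib sum.delta cong: if_cong)
  finally show ?thesis by (simp only: c_def E_def)
qed

lemma theta_plus_pos: "n \<ge> 1 \<Longrightarrow> \<theta> + real n > 0"
  using theta alpha by linarith

text \<open>
  The remaining probability: the frequencies add up to \<open>n = length L\<close>, so the repetitions
  together have weight \<open>n - \<alpha> |set L|\<close>.
\<close>

lemma prob_pattern_event_new:
  assumes n: "length L \<ge> 1"
  shows "prob (pattern_event M X (L @ [Suc (length L)])) =
    (\<theta> + real (card (set L)) * \<alpha>) / (\<theta> + real (length L)) * prob (pattern_event M X L)"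
proof (cases "pattern_event M X L = {}")
  case True
  then show ?thesis using pattern_event_snoc_subset[of M X L] by simp
next
  case False
  let ?n = "length L"
  let ?p = "prob (pattern_event M X L)"
  obtain \<omega> where "\<omega> \<in> pattern_event M X L" using False by blast
  then have "pattern X ?n \<omega> = L" by (auto simp: pattern_event_def)
  then have new: "Suc ?n \<notin> set L" using set_pattern_subset[of X ?n \<omega>] by auto
  have "?p = (\<Sum>k\<in>insert (Suc ?n) (set L). prob (pattern_event M X (L @ [k])))"
    by (subst pattern_event_Union, rule finite_measure_finite_Union)
       (auto simp: disjoint_pattern_event)
  also have "\<dots> = prob (pattern_event M X (L @ [Suc ?n])) +
      (\<Sum>k\<in>set L. (real (count_list L k) - \<alpha>) / (\<theta> + real ?n) * ?p)"
    using new by (simp add: prob_pattern_event_old[OF n])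
  also have "(\<Sum>k\<in>set L. (real (count_list L k) - \<alpha>) / (\<theta> + real ?n) * ?p) =
      (real ?n - real (card (set L)) * \<alpha>) / (\<theta> + real ?n) * ?p"
  proof -
    have "(\<Sum>k\<in>set L. real (count_list L k)) = real ?n"
      using sum_count_set[of L "set L"] by (simp flip: of_nat_sum)
    then show ?thesis
      by (simp add: sum_subtractf flip: sum_divide_distrib sum_distrib_right)
  qed
  finally show ?thesis
    using theta_plus_pos[OF n] by (simp add: field_simps)
qed

end

section \<open>Expectations given the frequencies\<close>

definition label_freqs :: "nat list \<Rightarrow> nat list" where
  "label_freqs L = map (count_list L) (labels L)"

lemma length_label_freqs: "length (label_freqs L) = card (set L)"
  by (simp add: label_freqs_def length_labels)

lemma sum_list_label_freqs: "sum_list (label_freqs L) = length L"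
  unfolding label_freqs_def
  by (subst sum_list_distinct_conv_sum_set) (simp_all add: sum_count_set)

lemma label_freqs_new:
  assumes "k \<notin> set L"
  shows "label_freqs (L @ [k]) = label_freqs L @ [1]"
  using assms by (auto simp: label_freqs_def labels_snoc)

text \<open>
  The last frequency belongs to the label introduced last; observing that label again increases it.
\<close>

lemma label_freqs_last:
  assumes "label_freqs L = ns @ [c]"
  shows "\<exists>k\<in>set L. count_list L k = c \<and> label_freqs (L @ [k]) = ns @ [Suc c]"
proof -
  obtain B k where Bk: "labels L = B @ [k]" "map (count_list L) B = ns" "count_list L k = c"
  proof (rule that)
    have "labels L \<noteq> []" using assms by (auto simp: label_freqs_def)
    then show *: "labels L = butlast (labels L) @ [last (labels L)]" by simp
    from assms have "map (count_list L) (butlast (labels L) @ [last (labels L)]) = ns @ [c]"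
      unfolding label_freqs_def by (simp only: *[symmetric])
    then show "map (count_list L) (butlast (labels L)) = ns" "count_list L (last (labels L)) = c"
      by simp_all
  qed
  have k: "k \<in> set L" using arg_cong[OF Bk(1), of set] by simp
  have "k \<notin> set B" using distinct_labels[of L] Bk(1) by simp
  then have "map (count_list (L @ [k])) B = ns"
    unfolding Bk(2)[symmetric] by (intro map_cong refl) auto
  then have "label_freqs (L @ [k]) = ns @ [Suc c]"
    unfolding label_freqs_def labels_snoc using k Bk by simp
  then show ?thesis using k Bk(3) by blast
qed

text \<open>
  First-step analysis of the chain: the expectation of \<open>g\<close> of the pattern after \<open>m\<close> further
  observations, starting from the pattern \<open>L\<close>.
\<close>

fun expected_after :: "real \<Rightarrow> real \<Rightarrow> (nat list \<Rightarrow> real) \<Rightarrow> nat \<Rightarrow> nat list \<Rightarrow> real" where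
  "expected_after \<alpha> \<theta> g 0 L = g L"
| "expected_after \<alpha> \<theta> g (Suc m) L =
     (\<theta> + real (card (set L)) * \<alpha>) / (\<theta> + real (length L)) * expected_after \<alpha> \<theta> g m (L @ [Suc (length L)])
     + (\<Sum>k\<in>set L. (real (count_list L k) - \<alpha>) / (\<theta> + real (length L)) * expected_after \<alpha> \<theta> g m (L @ [k]))"

context ewens_pitman
begin

lemma expectation_on_pattern_event:
  assumes "length L \<ge> 1"
  shows "set_integrable M (pattern_event M X L) (\<lambda>\<omega>. g (pattern X (length L + m) \<omega>))"
    and "(LINT \<omega>:pattern_event M X L|M. g (pattern X (length L + m) \<omega>)) =
      expected_after \<alpha> \<theta> g m L * prob (pattern_event M X L)"
proof -
  have "set_integrable M (pattern_event M X L) (\<lambda>\<omega>. g (pattern X (length L + m) \<omega>)) \<and>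
    (LINT \<omega>:pattern_event M X L|M. g (pattern X (length L + m) \<omega>)) =
      expected_after \<alpha> \<theta> g m L * prob (pattern_event M X L)"
    using assms
  proof (induction m arbitrary: L)
    case 0
    have *: "indicator (pattern_event M X L) \<omega> *\<^sub>R g (pattern X (length L + 0) \<omega>) =
        indicator (pattern_event M X L) \<omega> *\<^sub>R g L" for \<omega>
      by (auto simp: indicator_def pattern_event_def)
    show ?case
      unfolding set_integrable_def set_lebesgue_integral_def *
      by (simp add: emeasure_eq_measure Int_absorb1 sets.sets_into_space)
  next
    case (Suc m)
    let ?K = "insert (Suc (length L)) (set L)"
    have IH: "set_integrable M (pattern_event M X (L @ [k])) (\<lambda>\<omega>. g (pattern X (length L + Suc m) \<omega>))"
      "(LINT \<omega>:pattern_event M X (L @ [k])|M. g (pattern X (length L + Suc m) \<omega>)) =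
      expected_after \<alpha> \<theta> g m (L @ [k]) * prob (pattern_event M X (L @ [k]))" for k
      using Suc.IH[of "L @ [k]"] by simp_all
    have "set_integrable M (pattern_event M X L) (\<lambda>\<omega>. g (pattern X (length L + Suc m) \<omega>))"
      unfolding pattern_event_Union[of M X L] by (intro set_integrable_UN IH) auto
    moreover have "(LINT \<omega>:pattern_event M X L|M. g (pattern X (length L + Suc m) \<omega>)) =
      (\<Sum>k\<in>?K. LINT \<omega>:pattern_event M X (L @ [k])|M. g (pattern X (length L + Suc m) \<omega>))"
      unfolding pattern_event_Union[of M X L]
      by (rule set_integral_finite_Union) (auto simp: disjoint_pattern_event IH(1)[simplified])
    moreover have "\<dots> = expected_after \<alpha> \<theta> g (Suc m) L * prob (pattern_event M X L)"
    proof (cases "pattern_event M X L = {}")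
      case True
      then have "pattern_event M X (L @ [k]) = {}" for k
        using pattern_event_snoc_subset[of M X L k] by auto
      then show ?thesis using True by (simp add: set_lebesgue_integral_def)
    next
      case False
      then obtain \<omega> where "\<omega> \<in> pattern_event M X L" by blast
      then have "pattern X (length L) \<omega> = L" by (auto simp: pattern_event_def)
      then have "Suc (length L) \<notin> set L" using set_pattern_subset[of X "length L" \<omega>] by auto
      then show ?thesis
        unfolding IH(2) expected_after.simps distrib_right sum_distrib_right
        using prob_pattern_event_old[OF Suc.prems] prob_pattern_event_new[OF Suc.prems]
        by (subst sum.insert) (auto simp: mult_ac intro!: sum.cong)
    qed
    ultimately show ?case by simp
  qed
  then show "set_integrable M (pattern_event M X L) (\<lambda>\<omega>. g (pattern X (length L + m) \<omega>))"
    and "(LINT \<omega>:pattern_event M X L|M. g (pattern X (length L + m) \<omega>)) =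
      expected_after \<alpha> \<theta> g m L * prob (pattern_event M X L)" by auto
qed

lemma pattern_event_singleton: "pattern_event M X [1] = space M"
  using first_index[of 1 X] by (auto simp: pattern_event_def pattern_def intro: order_antisym)

text \<open>
  Observing each type in one uninterrupted run realises any vector of frequencies: a new label opens
  the next entry at \<open>1\<close>, and repeating the label introduced last raises the last entry. All these steps have
  positive probability since \<open>\<alpha> < 1\<close> and \<open>\<theta> > - \<alpha>\<close>.
\<close>

lemma pattern_with_frequencies_possible:
  assumes "ns \<noteq> []" "\<And>k. k \<in> set ns \<Longrightarrow> k \<ge> 1"
  shows "\<exists>L. label_freqs L = ns \<and> prob (pattern_event M X L) > 0"
  using assms
proof (induction ns rule: rev_induct)
  case (snoc c ns)
  have nonempty: "length L \<ge> 1" if "label_freqs L \<noteq> []" for L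
    using that by (cases L) (auto simp: label_freqs_def labels_def)
  have "\<exists>L. label_freqs L = ns @ [Suc c] \<and> prob (pattern_event M X L) > 0" for c
  proof (induction c)
    case 0
    show ?case
    proof (cases "ns = []")
      case True
      have "label_freqs [1] = ns @ [Suc 0]"
        by (simp add: True label_freqs_def labels_def)
      moreover have "prob (pattern_event M X [1]) > 0"
        by (simp only: pattern_event_singleton prob_space zero_less_one)
      ultimately show ?thesis by blast
    next
      case False
      then obtain L where L: "label_freqs L = ns" "prob (pattern_event M X L) > 0"
        using snoc by (auto)
      have n: "length L \<ge> 1" using nonempty L(1) False by blast
      obtain \<omega> where "\<omega> \<in> pattern_event M X L"
        using L(2) by (metis all_not_in_conv less_irrefl measure_empty)
      then have "pattern X (length L) \<omega> = L" by (auto simp: pattern_event_def)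
      then have "Suc (length L) \<notin> set L" using set_pattern_subset[of X "length L" \<omega>] by auto
      then have "label_freqs (L @ [Suc (length L)]) = ns @ [Suc 0]"
        using label_freqs_new L(1) by simp
      moreover have "prob (pattern_event M X (L @ [Suc (length L)])) > 0"
      proof -
        have "card (set L) \<ge> 1"
          using n by (cases L) (auto simp: card_gt_0_iff Suc_le_eq)
        then have "\<alpha> \<le> real (card (set L)) * \<alpha>" using alpha by simp
        then have "\<theta> + real (card (set L)) * \<alpha> > 0" using theta by linarith
        then show ?thesis
          unfolding prob_pattern_event_new[OF n] using L(2) theta_plus_pos[OF n] by simp
      qed
      ultimately show ?thesis by blast
    qed
  next
    case (Suc c)
    then obtain L where L: "label_freqs L = ns @ [Suc c]" "prob (pattern_event M X L) > 0" by blast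
    then obtain k where k: "k \<in> set L" "count_list L k = Suc c" "label_freqs (L @ [k]) = ns @ [Suc (Suc c)]"
      using label_freqs_last by blast
    have n: "length L \<ge> 1" using nonempty L(1) by simp
    have "real (count_list L k) - \<alpha> > 0" using alpha k(2) by simp
    then have "prob (pattern_event M X (L @ [k])) > 0"
      unfolding prob_pattern_event_old[OF n k(1)] using L(2) theta_plus_pos[OF n] by simp
    then show ?case using k(3) by blast
  qed
  from this[of "c - 1"] snoc.prems(2)[of c] show ?case by simp
qed simp

lemma freq_event_Union:
  "freq_event M X n j ns = (\<Union>L\<in>{L. set L \<subseteq> {1..n} \<and> length L = n \<and> card (set L) = j \<and> label_freqs L = ns}.
     pattern_event M X L)"
proof -
  have "\<omega> \<in> freq_event M X n j ns \<longleftrightarrow> \<omega> \<in> space M \<and>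
      card (set (pattern X n \<omega>)) = j \<and> label_freqs (pattern X n \<omega>) = ns" for \<omega>
    by (simp add: freq_event_def num_types_eq frequencies_eq label_freqs_def)
  then show ?thesis
    using set_pattern_subset[of X n] by (fastforce simp: pattern_event_def)
qed

text \<open>
  The conditioning event is a finite disjoint union of pattern events, and it has positive
  probability. If the expectation is the same on all of them, then conditioning returns it. The
  common value is allowed to be given as a complex number because it is computed as a coefficient
  of a complex series.
\<close>

lemma event_cond_exp_freq_event:
  assumes ns: "length ns = j" "\<And>k. k \<in> set ns \<Longrightarrow> k \<ge> 1" "sum_list ns = n" and n: "n \<ge> 1"
    and v: "\<And>L. set L \<subseteq> {1..n} \<Longrightarrow> length L = n \<Longrightarrow> card (set L) = j \<Longrightarrow>
      complex_of_real (expected_after \<alpha> \<theta> g m L) = v"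
  shows "complex_of_real (event_cond_exp M (\<lambda>\<omega>. g (pattern X (n + m) \<omega>)) (freq_event M X n j ns)) = v"
proof -
  define \<L> where "\<L> = {L. set L \<subseteq> {1..n} \<and> length L = n \<and> card (set L) = j \<and> label_freqs L = ns}"
  have fin: "finite \<L>"
    by (rule finite_subset[OF _ finite_lists_length_eq[of "{1..n}" n]]) (auto simp: \<L>_def)
  have union: "freq_event M X n j ns = (\<Union>L\<in>\<L>. pattern_event M X L)"
    unfolding \<L>_def by (rule freq_event_Union)
  have disj: "disjoint_family_on (pattern_event M X) \<L>"
    by (auto simp: disjoint_family_on_def pattern_event_def \<L>_def)
  have prob_eq: "prob (freq_event M X n j ns) = (\<Sum>L\<in>\<L>. prob (pattern_event M X L))"
    unfolding union by (rule finite_measure_finite_Union[OF fin _ disj]) auto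
  have "ns \<noteq> []" using ns(3) n by auto
  then obtain L where L: "label_freqs L = ns" "prob (pattern_event M X L) > 0"
    using pattern_with_frequencies_possible[OF _ ns(2)] by blast
  have "length L = n" using sum_list_label_freqs[of L] L(1) ns(3) by simp
  moreover have "card (set L) = j" using length_label_freqs[of L] L(1) ns(1) by simp
  moreover have "set L \<subseteq> {1..n}"
  proof -
    obtain \<omega> where "\<omega> \<in> pattern_event M X L"
      using L(2) by (metis all_not_in_conv less_irrefl measure_empty)
    then have "pattern X (length L) \<omega> = L" by (auto simp: pattern_event_def)
    then show ?thesis using set_pattern_subset[of X "length L" \<omega>] \<open>length L = n\<close> by simp
  qed
  ultimately have "L \<in> \<L>" using L(1) by (simp add: \<L>_def)
  then have pos: "prob (freq_event M X n j ns) > 0"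
    unfolding prob_eq using L(2) fin by (intro sum_pos2) auto
  define u where "u = expected_after \<alpha> \<theta> g m L"
  have u: "complex_of_real u = v"
    using v \<open>L \<in> \<L>\<close> by (simp add: u_def \<L>_def)
  have const: "expected_after \<alpha> \<theta> g m L' = u" if "L' \<in> \<L>" for L'
  proof -
    have "complex_of_real (expected_after \<alpha> \<theta> g m L') = complex_of_real u"
      unfolding u using v that by (simp add: \<L>_def)
    then show ?thesis by simp
  qed
  have "(LINT \<omega>:freq_event M X n j ns|M. g (pattern X (n + m) \<omega>)) =
      (\<Sum>L\<in>\<L>. LINT \<omega>:pattern_event M X L|M. g (pattern X (n + m) \<omega>))"
    unfolding union
  proof (rule set_integral_finite_Union[OF fin disj])
    fix L assume "L \<in> \<L>"
    then show "set_integrable M (pattern_event M X L) (\<lambda>\<omega>. g (pattern X (n + m) \<omega>))"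
      using expectation_on_pattern_event(1)[of L g m] n by (simp add: \<L>_def)
  qed simp
  also have "\<dots> = (\<Sum>L\<in>\<L>. u * prob (pattern_event M X L))"
  proof (intro sum.cong refl)
    fix L assume "L \<in> \<L>"
    then show "(LINT \<omega>:pattern_event M X L|M. g (pattern X (n + m) \<omega>)) = u * prob (pattern_event M X L)"
      using expectation_on_pattern_event(2)[of L g m] n const[of L] by (simp add: \<L>_def)
  qed
  also have "\<dots> = u * prob (freq_event M X n j ns)"
    by (simp add: prob_eq sum_distrib_left)
  finally show ?thesis
    using pos u by (simp add: event_cond_exp_def)
qed

end

section \<open>The generating function of a product of weights\<close>

text \<open>
  The exponential generating function of the weights \<open>w (c + i)\<close> that a type of current size \<open>c\<close> has after
  \<open>i\<close> further observations, weighted by the unnormalised transition weights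
  \<open>(c - a) (c - a + 1) \<cdots> (c - a + i - 1)\<close>.
\<close>

definition growth_fps :: "'a::field_char_0 \<Rightarrow> (nat \<Rightarrow> 'a) \<Rightarrow> nat \<Rightarrow> 'a fps" where
  "growth_fps a w c = Abs_fps (\<lambda>i. pochhammer (of_nat c - a) i * w (c + i) / fact i)"

text \<open>
  The antiderivative of \<^const>\<open>growth_fps\<close> at size \<open>1\<close>: the same function for a type that has not
  yet been seen. Its factor \<open>a\<close>, the weight that an existing type contributes to a birth, is left
  out.
\<close>

definition birth_fps :: "'a::field_char_0 \<Rightarrow> (nat \<Rightarrow> 'a) \<Rightarrow> 'a fps" where
  "birth_fps a w = Abs_fps (\<lambda>i. if i = 0 then 0 else pochhammer (1 - a) (i - 1) * w i / fact i)"

lemma birth_fps_nth_0 [simp]: "fps_nth (birth_fps a w) 0 = 0"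
  by (simp add: birth_fps_def)

lemma fps_deriv_growth_fps:
  "fps_deriv (growth_fps a w c) = fps_const (of_nat c - a) * growth_fps a w (Suc c)"
proof (rule fps_ext)
  fix i
  have "fact (Suc i) = (of_nat (Suc i) * fact i :: 'a)" by (rule fact_Suc)
  moreover have "of_nat c - a + 1 = of_nat (Suc c) - a" by simp
  ultimately show "fps_nth (fps_deriv (growth_fps a w c)) i
      = fps_nth (fps_const (of_nat c - a) * growth_fps a w (Suc c)) i"
    unfolding growth_fps_def fps_deriv_nth fps_mult_left_const_nth fps_nth_Abs_fps
    by (simp only: pochhammer_rec Suc_eq_plus1[symmetric]) (simp del: fact_Suc of_nat_Suc)
qed

lemma fps_deriv_birth_fps: "fps_deriv (birth_fps a w) = growth_fps a w 1"
  by (rule fps_ext) (simp add: birth_fps_def growth_fps_def of_nat_1[unfolded One_nat_def] of_nat_neq_0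
      del: of_nat_Suc)

lemma growth_fps_one: "growth_fps a (\<lambda>_. 1) c = rising_fps (of_nat c - a)"
  by (rule fps_ext) (simp add: growth_fps_def rising_fps_nth)

text \<open>
  Up to the sign and the constant term, \<open>(1 - s)\<^bsup>a\<^esup>\<close> is \<open>a\<close> times the birth series with all weights
  \<open>1\<close>.
\<close>

lemma rising_fps_neg_nth:
  "i > 0 \<Longrightarrow> fps_nth (rising_fps (- a)) i = - a * pochhammer (1 - a) (i - 1) / fact i"
  by (cases i) (simp_all add: rising_fps_nth pochhammer_rec)

lemma birth_fps_const:
  "1 - fps_const a * birth_fps a (\<lambda>_. z) = fps_const (1 - z) + fps_const z * rising_fps (- a)"
  by (rule fps_ext) (auto simp: birth_fps_def rising_fps_neg_nth fps_const_add[symmetric] simp del: fps_const_add)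

lemma birth_fps_single:
  assumes "l \<ge> 1"
  shows "1 - fps_const a * birth_fps a (\<lambda>i. if i = l then z else 1) =
    rising_fps (- a) - fps_const (a * pochhammer (1 - a) (l - 1) / fact l * (z - 1)) * fps_X ^ l"
  by (rule fps_ext) (use assms in \<open>auto simp: birth_fps_def rising_fps_neg_nth field_simps\<close>)

lemma fps_nth_0_prod: "fps_nth (\<Prod>k\<in>A. F k) 0 = (\<Prod>k\<in>A. fps_nth (F k :: 'a::comm_ring_1 fps) 0)"
  by (induction A rule: infinite_finite_induct) auto

lemma fps_deriv_prod_remove:
  assumes "finite A"
  shows "fps_deriv (\<Prod>k\<in>A. F k) = (\<Sum>k\<in>A. fps_deriv (F k) * (\<Prod>i\<in>A - {k}. F i :: 'a::comm_ring_1 fps))"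
  using assms
proof (induction A)
  case (insert x A)
  have "(\<Prod>i\<in>insert x A - {k}. F i) = F x * (\<Prod>i\<in>A - {k}. F i)" if "k \<in> A" for k
  proof -
    have "insert x A - {k} = insert x (A - {k})" using insert that by auto
    then show ?thesis using insert by simp
  qed
  then show ?case
    using insert by (simp add: sum_distrib_left mult_ac)
qed simp

lemma prod_rising_fps: "finite A \<Longrightarrow> (\<Prod>k\<in>A. rising_fps (f k)) = rising_fps (\<Sum>k\<in>A. f k)"
  by (induction A rule: finite_induct) (simp_all add: rising_fps_add)

text \<open>
  The generating function of a pattern: the labels of \<open>L\<close> evolve with weights \<open>W\<close>, types still to
  come with weight \<open>w\<close>. Each present type breeds new ones at rate \<open>a\<close>, and so do these in turn, which
  gives one factor \<open>1 / (1 - a B)\<close> for each present type.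
\<close>

definition pattern_fps :: "complex \<Rightarrow> (nat \<Rightarrow> complex) \<Rightarrow> (nat \<Rightarrow> nat \<Rightarrow> complex) \<Rightarrow> nat list \<Rightarrow> complex fps" where
  "pattern_fps a w W L = inverse (1 - fps_const a * birth_fps a w) ^ card (set L) *
     (\<Prod>k\<in>set L. growth_fps a (W k) (count_list L k))"

lemma pattern_fps_nth_0:
  "fps_nth (pattern_fps a w W L) 0 = (\<Prod>k\<in>set L. W k (count_list L k))"
  by (simp add: pattern_fps_def fps_nth_0_prod growth_fps_def fps_power_zeroth)

lemma pattern_fps_old:
  assumes "k \<in> set L"
  shows "pattern_fps a w W (L @ [k]) = inverse (1 - fps_const a * birth_fps a w) ^ card (set L) *
    (growth_fps a (W k) (Suc (count_list L k)) * (\<Prod>i\<in>set L - {k}. growth_fps a (W i) (count_list L i)))"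
proof -
  have "set (L @ [k]) = set L" using assms by auto
  moreover have "(\<Prod>i\<in>set L. growth_fps a (W i) (count_list (L @ [k]) i)) =
     growth_fps a (W k) (Suc (count_list L k)) * (\<Prod>i\<in>set L - {k}. growth_fps a (W i) (count_list L i))"
    using assms by (subst prod.remove[of _ k]) (auto intro!: arg_cong2[where f = "(*)"] prod.cong)
  ultimately show ?thesis by (simp only: pattern_fps_def)
qed

lemma pattern_fps_new:
  assumes k: "k \<notin> set L" and W: "W k = w"
  shows "pattern_fps a w W (L @ [k]) = inverse (1 - fps_const a * birth_fps a w) ^ Suc (card (set L)) *
    (growth_fps a w 1 * (\<Prod>i\<in>set L. growth_fps a (W i) (count_list L i)))"
proof -
  have "(\<Prod>i\<in>set L. growth_fps a (W i) (count_list (L @ [k]) i)) =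
     (\<Prod>i\<in>set L. growth_fps a (W i) (count_list L i))"
    using k by (intro prod.cong refl) auto
  moreover have "count_list (L @ [k]) k = 1" using k by simp
  ultimately show ?thesis
    unfolding pattern_fps_def using k by (simp add: W del: count_list_append)
qed

text \<open>
  The product rule reproduces the transitions of the chain: differentiating the factor of the label
  \<open>k\<close> repeats this label, and differentiating the power of \<open>1 / (1 - a B)\<close> creates a new one. The
  coefficients are the transition weights before normalisation.
\<close>

lemma fps_deriv_pattern_fps:
  assumes new: "k' \<notin> set L" and W: "W k' = w"
  shows "fps_deriv (pattern_fps a w W L) =
    fps_const (of_nat (card (set L)) * a) * pattern_fps a w W (L @ [k']) +
    (\<Sum>k\<in>set L. fps_const (of_nat (count_list L k) - a) * pattern_fps a w W (L @ [k]))"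
proof -
  define I where "I = inverse (1 - fps_const a * birth_fps a w)"
  let ?J = "card (set L)"
  let ?P = "\<Prod>i\<in>set L. growth_fps a (W i) (count_list L i)"
  have dI: "fps_deriv I = fps_const a * growth_fps a w 1 * I\<^sup>2"
    unfolding I_def by (subst fps_inverse_deriv) (simp_all add: fps_deriv_birth_fps)
  have "fps_deriv (I ^ ?J) = fps_const (of_nat ?J) * fps_deriv I * I ^ (?J - 1)"
    by (rule fps_deriv_power)
  also have "\<dots> = fps_const (of_nat ?J * a) * growth_fps a w 1 * I ^ Suc ?J"
  proof (cases ?J)
    case (Suc j)
    have *: "I ^ Suc (Suc j) = I\<^sup>2 * I ^ j" by (simp add: power2_eq_square mult_ac)
    show ?thesis
      unfolding dI Suc fps_const_mult[symmetric] * by (simp only: diff_Suc_1 mult_ac)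
  qed simp
  finally have dIJ: "fps_deriv (I ^ ?J) = fps_const (of_nat ?J * a) * growth_fps a w 1 * I ^ Suc ?J" .
  have dP: "fps_deriv ?P = (\<Sum>k\<in>set L. fps_const (of_nat (count_list L k) - a) *
      (growth_fps a (W k) (Suc (count_list L k)) * (\<Prod>i\<in>set L - {k}. growth_fps a (W i) (count_list L i))))"
    by (subst fps_deriv_prod_remove) (simp_all add: fps_deriv_growth_fps mult.assoc)
  have "fps_deriv (pattern_fps a w W L) = fps_deriv (I ^ ?J) * ?P + I ^ ?J * fps_deriv ?P"
    unfolding pattern_fps_def I_def[symmetric] by (simp only: fps_deriv_mult add.commute)
  also have "fps_deriv (I ^ ?J) * ?P = fps_const (of_nat ?J * a) * pattern_fps a w W (L @ [k'])"
    unfolding pattern_fps_new[where k = k' and L = L and W = W, OF new W] dIJ unfolding I_def by (simp only: mult_ac)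
  also have "I ^ ?J * fps_deriv ?P =
      (\<Sum>k\<in>set L. fps_const (of_nat (count_list L k) - a) * pattern_fps a w W (L @ [k]))"
    unfolding dP sum_distrib_left
    by (intro sum.cong refl) (simp only: pattern_fps_old I_def mult_ac)
  finally show ?thesis .
qed

text \<open>
  Comparing coefficients in \<open>fps_deriv_pattern_fps\<close> gives the recursion of \<^const>\<open>expected_after\<close>: the
  factor \<open>m + 1\<close> from the derivative builds up \<open>m!\<close>, and the normalisations \<open>1 / n, 1 / (n + 1), \<dots>\<close> build
  up the rising factorial.
\<close>

lemma expected_after_eq_coefficient:
  fixes W :: "nat \<Rightarrow> nat \<Rightarrow> real"
  assumes L: "length L \<ge> 1" "set L \<subseteq> {1..length L}"
    and W: "\<And>k. k > length L \<Longrightarrow> W k = w"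
    and g: "\<And>L. g L = (\<Prod>k\<in>set L. W k (count_list L k))"
  shows "complex_of_real (expected_after \<alpha> 0 g m L) = fact m / pochhammer (of_nat (length L)) m *
    fps_nth (pattern_fps (of_real \<alpha>) (\<lambda>i. of_real (w i)) (\<lambda>k i. of_real (W k i)) L) m"
  using L W
proof (induction m arbitrary: L)
  case 0
  show ?case by (simp add: pattern_fps_nth_0 g)
next
  case (Suc m)
  let ?H = "pattern_fps (of_real \<alpha>) (\<lambda>i. of_real (w i)) (\<lambda>k i. complex_of_real (W k i))"
  let ?n = "length L"
  let ?q = "fact m / pochhammer (of_nat (Suc ?n)) m :: complex"
  have new: "Suc ?n \<notin> set L" using Suc.prems(2) by auto
  have IH: "complex_of_real (expected_after \<alpha> 0 g m (L @ [k])) = ?q * fps_nth (?H (L @ [k])) m"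
    if "k \<in> insert (Suc ?n) (set L)" for k
  proof -
    have "set (L @ [k]) \<subseteq> {1..length (L @ [k])}" using Suc.prems(2) that by auto
    then show ?thesis
      using Suc.IH[of "L @ [k]"] Suc.prems(3) by simp
  qed
  have "complex_of_real (expected_after \<alpha> 0 g (Suc m) L) =
      of_nat (card (set L)) * of_real \<alpha> / of_nat ?n * (?q * fps_nth (?H (L @ [Suc ?n])) m) +
      (\<Sum>k\<in>set L. (of_nat (count_list L k) - of_real \<alpha>) / of_nat ?n * (?q * fps_nth (?H (L @ [k])) m))"
  proof -
    have "complex_of_real (expected_after \<alpha> 0 g (Suc m) L) =
        of_nat (card (set L)) * of_real \<alpha> / of_nat ?n * of_real (expected_after \<alpha> 0 g m (L @ [Suc ?n])) +
        (\<Sum>k\<in>set L. (of_nat (count_list L k) - of_real \<alpha>) / of_nat ?n * of_real (expected_after \<alpha> 0 g m (L @ [k])))"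
      by simp
    then show ?thesis
      unfolding IH[OF insertI1] by (simp only: IH[OF insertI2] cong: sum.cong)
  qed
  also have "\<dots> = ?q / of_nat ?n * fps_nth (fps_deriv (?H L)) m"
    using new Suc.prems(3)[of "Suc ?n"]
    by (subst fps_deriv_pattern_fps[of "Suc ?n"])
       (simp_all add: fps_sum_nth sum_distrib_left distrib_left mult_ac del: of_nat_Suc)
  also have "\<dots> = ?q / of_nat ?n * (of_nat (Suc m) * fps_nth (?H L) (Suc m))"
    by simp
  also have "\<dots> = fact (Suc m) / pochhammer (of_nat ?n) (Suc m) * fps_nth (?H L) (Suc m)"
    by (simp add: pochhammer_rec add.commute mult_ac)
  finally show ?case .
qed

text \<open>
  The labels up to \<open>n\<close> have weight \<open>1\<close>, so their factors are powers of \<open>1 - s\<close>, whose exponents add up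
  because the frequencies sum to \<open>n\<close>. The result depends on the pattern only through \<open>n\<close> and the
  number of its types.
\<close>

lemma expected_after_new_types:
  fixes w :: "nat \<Rightarrow> real"
  assumes L: "length L = n" "set L \<subseteq> {1..n}" and n: "n \<ge> 1"
    and g: "\<And>L. g L = (\<Prod>k\<in>set L. if k \<le> n then 1 else w (count_list L k))"
  shows "complex_of_real (expected_after \<alpha> 0 g m L) = fact m / pochhammer (of_nat n) m *
    fps_nth (inverse (1 - fps_const (of_real \<alpha>) * birth_fps (of_real \<alpha>) (\<lambda>i. of_real (w i))) ^ card (set L)
      * rising_fps (of_nat n - of_nat (card (set L)) * of_real \<alpha>)) m"
proof -
  let ?W = "\<lambda>k i. if k \<le> n then 1 else w i"
  have "(\<Prod>k\<in>set L. growth_fps (of_real \<alpha>) (\<lambda>i. complex_of_real (?W k i)) (count_list L k)) =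
      (\<Prod>k\<in>set L. rising_fps (of_nat (count_list L k) - of_real \<alpha>))"
    using L(2) by (intro prod.cong refl) (auto simp: growth_fps_one)
  also have "\<dots> = rising_fps (of_nat n - of_nat (card (set L)) * of_real \<alpha>)"
    using sum_count_set[of L "set L"] L(1)
    by (simp add: prod_rising_fps sum_subtractf flip: of_nat_sum)
  finally have "pattern_fps (of_real \<alpha>) (\<lambda>i. of_real (w i)) (\<lambda>k i. of_real (?W k i)) L =
     inverse (1 - fps_const (of_real \<alpha>) * birth_fps (of_real \<alpha>) (\<lambda>i. of_real (w i))) ^ card (set L)
      * rising_fps (of_nat n - of_nat (card (set L)) * of_real \<alpha>)"
    by (simp only: pattern_fps_def)
  then show ?thesis
    using expected_after_eq_coefficient[of L ?W w g \<alpha> m] L n g by simp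
qed

section \<open>The two choices of weights\<close>

text \<open>
  Here \<open>1 - a B(s) = 1 - z + z (1 - s)\<^bsup>a\<^esup> = z (1 - s)\<^bsup>a\<^esup> (1 - y (1 - s)\<^bsup>-a\<^esup>)\<close>. The powers of
  \<open>(1 - s)\<^bsup>a\<^esup>\<close> cancel against the exponent \<open>b - j a\<close>, and what remains is a series in \<open>s / (1 - s)\<close>.
\<close>

lemma coefficient_constant_weight:
  fixes a z :: "'a::field_char_0"
  assumes z: "z \<noteq> 0" and y: "y = 1 - 1 / z"
  shows "fps_nth (inverse (1 - fps_const a * birth_fps a (\<lambda>_. z)) ^ j * rising_fps (b - of_nat j * a)) m =
    inverse z ^ j * fps_nth (fps_binomial (b + of_nat m - 1) * inverse (1 - fps_const y * fps_binomial a) ^ j) m"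
proof -
  have y1: "1 - y \<noteq> 0" using z y by simp
  have aa: "rising_fps (- a) * rising_fps a = 1"
    using rising_fps_add[of "-a" a] by simp
  have "1 - z = - (z * y)" using z y by (simp add: field_simps)
  then have "1 - fps_const a * birth_fps a (\<lambda>_. z) = fps_const z * (rising_fps (-a) - fps_const y)"
    by (simp add: birth_fps_const algebra_simps flip: fps_const_mult fps_const_neg)
  also have "rising_fps (-a) - fps_const y = rising_fps (-a) * (1 - fps_const y * rising_fps a)"
    using aa by (simp add: algebra_simps)
  finally have *: "inverse (1 - fps_const a * birth_fps a (\<lambda>_. z))
    = fps_const (inverse z) * (inverse (rising_fps (-a)) * inverse (1 - fps_const y * rising_fps a))"
    by (simp add: fps_inverse_mult fps_const_inverse)
  have "inverse (rising_fps (-a)) = rising_fps a"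
    by (rule fps_inverse_unique[OF aa])
  then have "inverse (1 - fps_const a * birth_fps a (\<lambda>_. z)) ^ j * rising_fps (b - of_nat j * a)
     = fps_const (inverse z ^ j) * (rising_fps (of_nat j * a) * rising_fps (b - of_nat j * a)
         * inverse (1 - fps_const y * rising_fps a) ^ j)"
    by (simp add: * power_mult_distrib fps_const_power rising_fps_power mult_ac)
  also have "rising_fps (of_nat j * a) * rising_fps (b - of_nat j * a) = rising_fps b"
    by (simp flip: rising_fps_add)
  also have "inverse (1 - fps_const y * rising_fps a) ^ j = inverse (1 - fps_const y * fps_binomial a) ^ j oo moebius_fps"
    using y1 by (simp add: rising_fps_def fps_compose_power[symmetric] fps_inverse_compose
        fps_compose_sub_distrib fps_compose_mult_distrib)
  finally show ?thesis
    by (simp only: fps_mult_left_const_nth fps_nth_change_of_variable)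
qed

text \<open>
  Changing only the weight of \<open>l\<close> perturbs \<open>(1 - s)\<^bsup>a\<^esup>\<close> by the single term \<open>y s\<^bsup>l\<^esup>\<close>. With \<open>x = s / (1 - s)\<close>,
  \<open>s\<^bsup>l\<^esup> (1 - s)\<^bsup>-a\<^esup> = x\<^bsup>l\<^esup> (1 + x)\<^bsup>a-l\<^esup>\<close>, which is where the exponent \<open>\<alpha> - l\<close> in the integrands comes from.
\<close>

lemma coefficient_single_frequency_weight:
  fixes a z :: "'a::field_char_0"
  assumes l: "l \<ge> 1" and y: "y = a * pochhammer (1 - a) (l - 1) / fact l * (z - 1)"
  shows "fps_nth (inverse (1 - fps_const a * birth_fps a (\<lambda>i. if i = l then z else 1)) ^ j
             * rising_fps (b - of_nat j * a)) m =
    fps_nth (fps_binomial (b + of_nat m - 1) *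
       inverse (1 - fps_const y * fps_binomial (a - of_nat l) * fps_X ^ l) ^ j) m"
proof -
  have aa: "rising_fps (- a) * rising_fps a = 1"
    using rising_fps_add[of "-a" a] by simp
  have "1 - fps_const a * birth_fps a (\<lambda>i. if i = l then z else 1) =
    rising_fps (- a) - fps_const y * fps_X ^ l"
    by (simp only: birth_fps_single[OF l] y)
  also have "\<dots> = rising_fps (-a) * (1 - fps_const y * rising_fps a * fps_X ^ l)"
    using aa by (simp add: algebra_simps)
  finally have *: "inverse (1 - fps_const a * birth_fps a (\<lambda>i. if i = l then z else 1))
    = inverse (rising_fps (-a)) * inverse (1 - fps_const y * rising_fps a * fps_X ^ l)"
    by (simp add: fps_inverse_mult)
  have "inverse (rising_fps (-a)) = rising_fps a"
    by (rule fps_inverse_unique[OF aa])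
  then have "inverse (1 - fps_const a * birth_fps a (\<lambda>i. if i = l then z else 1)) ^ j * rising_fps (b - of_nat j * a)
     = rising_fps (of_nat j * a) * rising_fps (b - of_nat j * a)
         * inverse (1 - fps_const y * rising_fps a * fps_X ^ l) ^ j"
    by (simp add: * power_mult_distrib rising_fps_power mult_ac)
  also have "rising_fps (of_nat j * a) * rising_fps (b - of_nat j * a) = rising_fps b"
    by (simp flip: rising_fps_add)
  also have "rising_fps a = (fps_binomial (a - of_nat l) oo moebius_fps) * rising_fps (of_nat l)"
    by (simp flip: rising_fps_add rising_fps_def)
  also have "inverse (1 - fps_const y * ((fps_binomial (a - of_nat l) oo moebius_fps) * rising_fps (of_nat l)) * fps_X ^ l) ^ j
     = inverse (1 - fps_const y * fps_binomial (a - of_nat l) * fps_X ^ l) ^ j oo moebius_fps"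
    using l by (simp add: fps_compose_power[symmetric] fps_inverse_compose
        fps_compose_sub_distrib fps_compose_mult_distrib moebius_fps_power mult_ac)
  finally show ?thesis
    by (simp only: fps_nth_change_of_variable)
qed

lemma prod_if_power:
  "finite A \<Longrightarrow> (\<Prod>k\<in>A. if P k then z else 1) = (z :: real) ^ card {k \<in> A. P k}"
  by (simp flip: prod.inter_filter)

lemma scaled_exponent:
  fixes \<alpha> \<beta> :: real
  assumes "0 < \<alpha>" "\<alpha> < 1" "\<beta> > 0"
  shows "\<beta> powr (1 / (1 - \<alpha>)) = \<beta> powr (\<alpha> / (1 - \<alpha>)) * \<beta>"
proof -
  have "1 / (1 - \<alpha>) = \<alpha> / (1 - \<alpha>) + 1"
  proof -
    have "1 - \<alpha> \<noteq> 0" using assms by simp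
    then show ?thesis by (simp add: field_simps)
  qed
  then show ?thesis
    using assms by (simp add: powr_add)
qed

text \<open>
  The number \<open>z\<close> for which the exponential moments are expectations of \<open>z\<close> to the power of the
  count.
\<close>

definition tilt :: "real \<Rightarrow> real \<Rightarrow> (nat \<Rightarrow> real) \<Rightarrow> nat \<Rightarrow> real" where
  "tilt \<alpha> lam \<beta> n = exp (lam * \<beta> n powr (\<alpha> / (1 - \<alpha>)) / real n powr \<alpha>)"

lemma tilt_pos: "tilt \<alpha> lam \<beta> n > 0"
  by (simp add: tilt_def)

lemma exp_scaled_count:
  assumes "0 < \<alpha>" "\<alpha> < 1" "\<beta> n > 0"
  shows "exp (lam * (\<beta> n powr (1 / (1 - \<alpha>)) * real K / (real n powr \<alpha> * \<beta> n))) = tilt \<alpha> lam \<beta> n ^ K"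
proof -
  have "lam * (\<beta> n powr (1 / (1 - \<alpha>)) * real K / (real n powr \<alpha> * \<beta> n)) =
      real K * (lam * \<beta> n powr (\<alpha> / (1 - \<alpha>)) / real n powr \<alpha>)"
    using assms by (simp add: scaled_exponent)
  then show ?thesis
    by (simp only: tilt_def exp_of_nat_mult)
qed

lemma y_seq_eq: "y_seq \<alpha> lam \<beta> n = 1 - 1 / tilt \<alpha> lam \<beta> n"
  by (simp add: y_seq_def tilt_def exp_minus inverse_eq_divide)

lemma yl_seq_eq:
  "yl_seq \<alpha> lam \<beta> l n = \<alpha> * pochhammer (1 - \<alpha>) (l - 1) / fact l * (tilt \<alpha> lam \<beta> n - 1)"
  using tilt_pos[of \<alpha> lam \<beta> n] by (simp add: yl_seq_def y_seq_eq field_simps)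

context
  fixes M :: "'w measure" and \<nu> :: "'a::polish_space measure"
    and X :: "nat \<Rightarrow> 'w \<Rightarrow> 'a" and \<alpha> :: real
  assumes model: "ewens_pitman M \<nu> X \<alpha> 0"
begin

interpretation ewens_pitman M \<nu> X \<alpha> 0 by (rule model)

text \<open>
  The first observation is certain to form the pattern \<open>[1]\<close>, and \<open>n - 1\<close> further ones complete the
  sample. All labels have weight \<open>z\<close> here; the factor \<open>z\<close> of the first type cancels the \<open>1 / z\<close> of
  \<open>coefficient_constant_weight\<close>.
\<close>

lemma phi_coefficient:
  assumes n: "n \<ge> 1" and \<beta>: "\<beta> n > 0"
  shows "complex_of_real (phi M X \<alpha> lam \<beta> n) =
    fps_nth (fps_binomial (of_nat (n - 1)) *
      inverse (1 - fps_const (of_real (y_seq \<alpha> lam \<beta> n)) * fps_binomial (of_real \<alpha>)) ^ 1) (n - 1)"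
proof -
  define z where "z = tilt \<alpha> lam \<beta> n"
  define g where "g L = (\<Prod>k\<in>set L. (\<lambda>_ _. z) k (count_list L k))" for L :: "nat list"
  let ?a = "complex_of_real \<alpha>"
  have z: "z > 0" by (simp add: z_def tilt_pos)
  have "phi M X \<alpha> lam \<beta> n = (LINT \<omega>|M. g (pattern X n \<omega>))"
    unfolding phi_def exp_scaled_count[where \<beta> = \<beta> and n = n, OF alpha \<beta>] by (simp add: g_def z_def num_types_eq)
  also have "\<dots> = (LINT \<omega>:pattern_event M X [1]|M. g (pattern X (length [1::nat] + (n - 1)) \<omega>))"
    unfolding pattern_event_singleton set_lebesgue_integral_def using n
    by (simp cong: Bochner_Integration.integral_cong)
  also have "\<dots> = expected_after \<alpha> 0 g (n - 1) [1]"
    by (subst expectation_on_pattern_event(2)) (simp_all add: pattern_event_singleton prob_space del: One_nat_def)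
  finally have "complex_of_real (phi M X \<alpha> lam \<beta> n) =
      fact (n - 1) / pochhammer (of_nat (length [1::nat])) (n - 1) *
      fps_nth (pattern_fps ?a (\<lambda>i. of_real z) (\<lambda>k i. of_real z) [1]) (n - 1)"
    by (simp only:) (rule expected_after_eq_coefficient, simp_all add: g_def)
  also have "fact (n - 1) / pochhammer (of_nat (length [1::nat])) (n - 1) = (1 :: complex)"
    by (simp add: pochhammer_fact[symmetric])
  also have "pattern_fps ?a (\<lambda>i. of_real z) (\<lambda>k i. of_real z) [1] =
      fps_const (of_real z) *
      (inverse (1 - fps_const ?a * birth_fps ?a (\<lambda>_. of_real z)) ^ 1 * rising_fps (1 - of_nat 1 * ?a))"
  proof -
    have "growth_fps ?a (\<lambda>i. of_real z) 1 = fps_const (of_real z) * growth_fps ?a (\<lambda>_. 1) 1"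
      by (rule fps_ext) (simp add: growth_fps_def)
    then show ?thesis
      by (simp add: pattern_fps_def growth_fps_one mult_ac)
  qed
  also have "1 * fps_nth (fps_const (complex_of_real z) *
      (inverse (1 - fps_const ?a * birth_fps ?a (\<lambda>_. of_real z)) ^ 1 * rising_fps (1 - of_nat 1 * ?a))) (n - 1)
    = of_real z * (inverse (of_real z) ^ 1 * fps_nth (fps_binomial (1 + of_nat (n - 1) - 1) *
      inverse (1 - fps_const (of_real (y_seq \<alpha> lam \<beta> n)) * fps_binomial ?a) ^ 1) (n - 1))"
    unfolding mult_1 fps_mult_left_const_nth
    using z by (subst coefficient_constant_weight[where y = "of_real (y_seq \<alpha> lam \<beta> n)"]) (simp_all add: y_seq_eq z_def)
  finally show ?thesis using z by simp
qed

text \<open>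
  The weight is \<open>z\<close> to the number of new types, and the normalisation is
  \<open>m! / n\<^bsub>(m)\<^esub> = 1 / (n + m - 1 choose m)\<close>.
\<close>

lemma phi_cond_coefficient:
  assumes n: "n \<ge> 1" and \<beta>: "\<beta> m > 0"
    and ns: "length ns = j" "\<And>k. k \<in> set ns \<Longrightarrow> k \<ge> 1" "sum_list ns = n"
  shows "complex_of_real (phi_cond M X \<alpha> lam \<beta> n m j ns) =
    of_real ((1 - y_seq \<alpha> lam \<beta> m) ^ j / real ((n + m - 1) choose m)) *
    fps_nth (fps_binomial (of_nat (n + m - 1)) *
      inverse (1 - fps_const (of_real (y_seq \<alpha> lam \<beta> m)) * fps_binomial (of_real \<alpha>)) ^ j) m"
proof -
  define z where "z = tilt \<alpha> lam \<beta> m"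
  define g where "g L = (\<Prod>k\<in>set L. if k \<le> n then 1 else z)" for L :: "nat list"
  let ?a = "complex_of_real \<alpha>"
  define C :: complex where "C = fps_nth (fps_binomial (of_nat (n + m - 1)) *
      inverse (1 - fps_const (of_real (y_seq \<alpha> lam \<beta> m)) * fps_binomial ?a) ^ j) m"
  have z: "z > 0" by (simp add: z_def tilt_pos)
  have nm: "of_nat n + of_nat m - 1 = (of_nat (n + m - 1) :: complex)"
    using n by (simp add: of_nat_diff)
  have E: "complex_of_real (expected_after \<alpha> 0 g m L) =
      of_real ((1 - y_seq \<alpha> lam \<beta> m) ^ j / real ((n + m - 1) choose m)) * C"
    if L: "set L \<subseteq> {1..n}" "length L = n" "card (set L) = j" for L
  proof -
    have "complex_of_real (expected_after \<alpha> 0 g m L) = fact m / pochhammer (of_nat n) m *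
        fps_nth (inverse (1 - fps_const ?a * birth_fps ?a (\<lambda>i. of_real z)) ^ card (set L)
          * rising_fps (of_nat n - of_nat (card (set L)) * ?a)) m"
      by (rule expected_after_new_types[OF L(2,1) n]) (simp add: g_def)
    also have "\<dots> = fact m / pochhammer (of_nat n) m * (inverse (of_real z) ^ j * C)"
      unfolding L(3) C_def nm[symmetric] using z
      by (subst coefficient_constant_weight[where y = "of_real (y_seq \<alpha> lam \<beta> m)"]) (simp_all add: y_seq_eq z_def)
    also have "fact m / pochhammer (of_nat n) m = (1 / of_nat ((n + m - 1) choose m) :: complex)"
    proof -
      have "of_nat ((n + m - 1) choose m) = (of_nat n + of_nat m - 1 gchoose m :: complex)"
        by (simp add: binomial_gbinomial nm)
      also have "\<dots> = pochhammer (of_nat n) m / fact m"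
        by (simp add: gbinomial_pochhammer')
      finally show ?thesis by simp
    qed
    also have "inverse (complex_of_real z) = of_real (1 - y_seq \<alpha> lam \<beta> m)"
      by (simp add: y_seq_eq z_def inverse_eq_divide)
    finally show ?thesis by simp
  qed
  have "complex_of_real (event_cond_exp M (\<lambda>\<omega>. g (pattern X (n + m) \<omega>)) (freq_event M X n j ns)) =
      of_real ((1 - y_seq \<alpha> lam \<beta> m) ^ j / real ((n + m - 1) choose m)) * C"
    by (rule event_cond_exp_freq_event[where g = g and m = m and n = n and j = j]; use ns n E in blast)
  moreover have "phi_cond M X \<alpha> lam \<beta> n m j ns =
      event_cond_exp M (\<lambda>\<omega>. g (pattern X (n + m) \<omega>)) (freq_event M X n j ns)"
  proof -
    have "exp (lam * \<beta> m powr (1 / (1 - \<alpha>)) * (real (num_new_types X n m \<omega>) / (real m powr \<alpha> * \<beta> m)))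
        = g (pattern X (n + m) \<omega>)" for \<omega>
    proof -
      have "g (pattern X (n + m) \<omega>) = (\<Prod>k\<in>set (pattern X (n + m) \<omega>). if n < k then z else 1)"
        unfolding g_def by (intro prod.cong) auto
      then show ?thesis
        using exp_scaled_count[of \<alpha> \<beta> m lam "num_new_types X n m \<omega>"] alpha \<beta>
        by (simp add: prod_if_power num_new_types_eq z_def mult.assoc)
    qed
    then show ?thesis by (simp only: phi_cond_def)
  qed
  ultimately show ?thesis by (simp only: C_def)
qed

text \<open>
  Only the new types that end up with frequency \<open>l\<close> carry the weight \<open>z\<close>.
\<close>

lemma phi_cond_freq_coefficient:
  assumes l: "l \<ge> 1" and n: "n \<ge> 1" and \<beta>: "\<beta> m > 0"
    and ns: "length ns = j" "\<And>k. k \<in> set ns \<Longrightarrow> k \<ge> 1" "sum_list ns = n"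
  shows "complex_of_real (phi_cond_freq M X \<alpha> lam \<beta> l n m j ns) =
    of_real (fact m / pochhammer (real n) m) *
    fps_nth (fps_binomial (of_nat (n + m - 1)) *
      inverse (1 - fps_const (of_real (yl_seq \<alpha> lam \<beta> l m)) * fps_binomial (of_real (\<alpha> - real l)) * fps_X ^ l) ^ j) m"
proof -
  define z where "z = tilt \<alpha> lam \<beta> m"
  define w where "w c = (if c = l then z else 1)" for c :: nat
  define g where "g L = (\<Prod>k\<in>set L. if k \<le> n then 1 else w (count_list L k))" for L :: "nat list"
  let ?a = "complex_of_real \<alpha>"
  define C :: complex where "C = fps_nth (fps_binomial (of_nat (n + m - 1)) *
      inverse (1 - fps_const (of_real (yl_seq \<alpha> lam \<beta> l m)) * fps_binomial (of_real (\<alpha> - real l)) * fps_X ^ l) ^ j) m"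
  have nm: "of_nat n + of_nat m - 1 = (of_nat (n + m - 1) :: complex)"
    using n by (simp add: of_nat_diff)
  have w: "(\<lambda>i. complex_of_real (w i)) = (\<lambda>i. if i = l then of_real z else 1)"
    by (simp add: w_def fun_eq_iff)
  have yl: "complex_of_real (yl_seq \<alpha> lam \<beta> l m) = ?a * pochhammer (1 - ?a) (l - 1) / fact l * (of_real z - 1)"
  proof -
    have "pochhammer (1 - ?a) (l - 1) = of_real (pochhammer (1 - \<alpha>) (l - 1))"
      using pochhammer_of_real[of "1 - \<alpha>" "l - 1", where 'a = complex] by simp
    then show ?thesis by (simp add: yl_seq_eq z_def)
  qed
  have al: "complex_of_real (\<alpha> - real l) = ?a - of_nat l" by simp
  have E: "complex_of_real (expected_after \<alpha> 0 g m L) = of_real (fact m / pochhammer (real n) m) * C"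
    if L: "set L \<subseteq> {1..n}" "length L = n" "card (set L) = j" for L
  proof -
    have "complex_of_real (expected_after \<alpha> 0 g m L) = fact m / pochhammer (of_nat n) m *
        fps_nth (inverse (1 - fps_const ?a * birth_fps ?a (\<lambda>i. of_real (w i))) ^ card (set L)
          * rising_fps (of_nat n - of_nat (card (set L)) * ?a)) m"
      by (rule expected_after_new_types[OF L(2,1) n]) (simp add: g_def)
    also have "\<dots> = fact m / pochhammer (of_nat n) m * C"
      unfolding L(3) w C_def nm[symmetric] al by (subst coefficient_single_frequency_weight[OF l yl]) (rule refl)
    also have "fact m / pochhammer (of_nat n) m = complex_of_real (fact m / pochhammer (real n) m)"
      by (simp flip: pochhammer_of_real)
    finally show ?thesis .
  qed
  have "complex_of_real (event_cond_exp M (\<lambda>\<omega>. g (pattern X (n + m) \<omega>)) (freq_event M X n j ns)) =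
      of_real (fact m / pochhammer (real n) m) * C"
    by (rule event_cond_exp_freq_event[where g = g and m = m and n = n and j = j]; use ns n E in blast)
  moreover have "phi_cond_freq M X \<alpha> lam \<beta> l n m j ns =
      event_cond_exp M (\<lambda>\<omega>. g (pattern X (n + m) \<omega>)) (freq_event M X n j ns)"
  proof -
    have "exp (lam * \<beta> m powr (1 / (1 - \<alpha>)) * (real (num_new_types_freq X l n m \<omega>) / (real m powr \<alpha> * \<beta> m)))
        = g (pattern X (n + m) \<omega>)" for \<omega>
    proof -
      have "g (pattern X (n + m) \<omega>) = (\<Prod>k\<in>set (pattern X (n + m) \<omega>).
          if n < k \<and> count_list (pattern X (n + m) \<omega>) k = l then z else 1)"
        unfolding g_def w_def by (intro prod.cong) auto
      then show ?thesis
        using exp_scaled_count[of \<alpha> \<beta> m lam "num_new_types_freq X l n m \<omega>"] alpha \<beta>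
        by (simp add: prod_if_power num_new_types_freq_eq z_def mult.assoc)
    qed
    then show ?thesis by (simp only: phi_cond_freq_def)
  qed
  ultimately show ?thesis by (simp only: C_def)
qed

end

lemma of_real_gbinomial: "complex_of_real (x gchoose k) = of_real x gchoose k"
  by (simp add: gbinomial_pochhammer' flip: pochhammer_of_real)

lemma phi_tilde_coefficient:
  assumes l: "l \<ge> 1"
  shows "complex_of_real (phi_tilde \<alpha> lam \<beta> l n) =
    fps_nth (fps_binomial (of_nat n) *
      inverse (1 - fps_const (of_real (yl_seq \<alpha> lam \<beta> l n)) * fps_binomial (of_real (\<alpha> - real l)) * fps_X ^ l) ^ 1) n"
  unfolding power_one_right geometric_coefficient[OF l] phi_tilde_def
  by (simp add: of_real_gbinomial algebra_simps)

section \<open>The integral representations\<close>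

theorem theorem2p1:
  fixes M :: "'w measure" and \<nu> :: "'a::polish_space measure"
    and X :: "nat \<Rightarrow> 'w \<Rightarrow> 'a"
    and \<alpha> lam :: real and \<beta> :: "nat \<Rightarrow> real"
    and l n m j :: nat and ns :: "nat list"
  assumes model: "ewens_pitman M \<nu> X \<alpha> 0"
    and l: "l \<ge> 1"
    and beta_pos: "\<And>k. k \<ge> 1 \<Longrightarrow> \<beta> k > 0"
    and beta_lim: "filterlim \<beta> at_top sequentially"
    and beta_growth: "(\<lambda>k. \<beta> k / real k powr (1 - \<alpha>)) \<longlonglongrightarrow> 0"
    and n: "n \<ge> 1" and m: "m \<ge> 1" and j: "1 \<le> j" "j \<le> n"
    and ns: "length ns = j" "\<And>k. k \<in> set ns \<Longrightarrow> k \<ge> 1" "sum_list ns = n"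
  shows
    "(let f = (\<lambda>\<xi>::complex. \<xi> ^ (n - 1) /
               ((\<xi> - 1) ^ n * (1 - of_real (y_seq \<alpha> lam \<beta> n) * \<xi> powr of_real \<alpha>)))
     in (\<forall>\<^sub>F r in at_right 0. only_singularity f 1 r) \<and>
        (\<forall>r. only_singularity f 1 r \<longrightarrow>
          complex_of_real (phi M X \<alpha> lam \<beta> n) =
            1 / (2 * of_real pi * \<i>) * contour_integral (circlepath 1 r) f))
    \<and>
    (let f = (\<lambda>\<xi>::complex. \<xi> ^ n /
               ((\<xi> - 1) ^ (n + 1) *
                (1 - of_real (yl_seq \<alpha> lam \<beta> l n) * \<xi> powr of_real (\<alpha> - real l) * (\<xi> - 1) ^ l)))
     in (\<forall>\<^sub>F r in at_right 0. only_singularity f 1 r) \<and>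
        (\<forall>r. only_singularity f 1 r \<longrightarrow>
          complex_of_real (phi_tilde \<alpha> lam \<beta> l n) =
            1 / (2 * of_real pi * \<i>) * contour_integral (circlepath 1 r) f))
    \<and>
    (let f = (\<lambda>\<xi>::complex. \<xi> ^ (n + m - 1) / (\<xi> - 1) ^ (m + 1) *
               (1 / (1 - of_real (y_seq \<alpha> lam \<beta> m) * \<xi> powr of_real \<alpha>) ^ j))
     in (\<forall>\<^sub>F r in at_right 0. only_singularity f 1 r) \<and>
        (\<forall>r. only_singularity f 1 r \<longrightarrow>
          complex_of_real (phi_cond M X \<alpha> lam \<beta> n m j ns) =
            of_real ((1 - y_seq \<alpha> lam \<beta> m) ^ j / real ((n + m - 1) choose m)) *
            (1 / (2 * of_real pi * \<i>)) * contour_integral (circlepath 1 r) f))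
    \<and>
    (let f = (\<lambda>\<xi>::complex. \<xi> ^ (n + m - 1) /
               ((\<xi> - 1) ^ (m + 1) *
                (1 - of_real (yl_seq \<alpha> lam \<beta> l m) * \<xi> powr of_real (\<alpha> - real l) * (\<xi> - 1) ^ l) ^ j))
     in (\<forall>\<^sub>F r in at_right 0. only_singularity f 1 r) \<and>
        (\<forall>r. only_singularity f 1 r \<longrightarrow>
          complex_of_real (phi_cond_freq M X \<alpha> lam \<beta> l n m j ns) =
            of_real (fact m / pochhammer (real n) m) *
            (1 / (2 * of_real pi * \<i>)) * contour_integral (circlepath 1 r) f))"
proof -
  interpret ewens_pitman M \<nu> X \<alpha> 0 by (rule model)
  let ?y = "\<lambda>n. complex_of_real (y_seq \<alpha> lam \<beta> n)"
  let ?yl = "\<lambda>n. complex_of_real (yl_seq \<alpha> lam \<beta> l n)"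
  let ?a = "complex_of_real \<alpha>" and ?al = "complex_of_real (\<alpha> - real l)"
  have y_ne_1: "?y n \<noteq> 1" for n
    using tilt_pos[of \<alpha> lam \<beta> n] by (simp add: y_seq_eq)
  have y_expansion: "(\<lambda>x. (1 + x) ^ N * (1 / (1 - ?y k * (1 + x) powr ?a)) ^ i)
      has_fps_expansion fps_binomial (of_nat N) * inverse (1 - fps_const (?y k) * fps_binomial ?a) ^ i" for N k i
    using kernel_has_fps_expansion[of 0 "?y k" N ?a i] y_ne_1[of k] by simp
  have yl_expansion: "(\<lambda>x. (1 + x) ^ N * (1 / (1 - ?yl k * (1 + x) powr ?al * x ^ l)) ^ i)
      has_fps_expansion fps_binomial (of_nat N) *
        inverse (1 - fps_const (?yl k) * fps_binomial ?al * fps_X ^ l) ^ i" for N k i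
    using l by (intro kernel_has_fps_expansion) simp
  show ?thesis
    unfolding Let_def
  proof (rule conjI[OF _ conjI[OF _ conjI]])
    show "(\<forall>\<^sub>F r in at_right 0. only_singularity (\<lambda>\<xi>. \<xi> ^ (n - 1) /
               ((\<xi> - 1) ^ n * (1 - ?y n * \<xi> powr ?a))) 1 r) \<and>
        (\<forall>r. only_singularity (\<lambda>\<xi>. \<xi> ^ (n - 1) /
               ((\<xi> - 1) ^ n * (1 - ?y n * \<xi> powr ?a))) 1 r \<longrightarrow>
          complex_of_real (phi M X \<alpha> lam \<beta> n) =
            1 / (2 * of_real pi * \<i>) * contour_integral (circlepath 1 r) (\<lambda>\<xi>. \<xi> ^ (n - 1) /
               ((\<xi> - 1) ^ n * (1 - ?y n * \<xi> powr ?a))))"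
    proof (rule contour_formula_unscaled[OF y_expansion[of "n - 1" n 1]])
      show "complex_of_real (phi M X \<alpha> lam \<beta> n) =
        fps_nth (fps_binomial (of_nat (n - 1)) * inverse (1 - fps_const (?y n) * fps_binomial ?a) ^ 1) (n - 1)"
        by (rule phi_coefficient[where \<beta> = \<beta> and n = n, OF model n beta_pos[OF n]])
    qed (use n in simp)
  next
    show "(\<forall>\<^sub>F r in at_right 0. only_singularity (\<lambda>\<xi>. \<xi> ^ n /
               ((\<xi> - 1) ^ (n + 1) * (1 - ?yl n * \<xi> powr ?al * (\<xi> - 1) ^ l))) 1 r) \<and>
        (\<forall>r. only_singularity (\<lambda>\<xi>. \<xi> ^ n /
               ((\<xi> - 1) ^ (n + 1) * (1 - ?yl n * \<xi> powr ?al * (\<xi> - 1) ^ l))) 1 r \<longrightarrow>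
          complex_of_real (phi_tilde \<alpha> lam \<beta> l n) =
            1 / (2 * of_real pi * \<i>) * contour_integral (circlepath 1 r) (\<lambda>\<xi>. \<xi> ^ n /
               ((\<xi> - 1) ^ (n + 1) * (1 - ?yl n * \<xi> powr ?al * (\<xi> - 1) ^ l))))"
      by (rule contour_formula_unscaled[OF yl_expansion[of n n 1] _ phi_tilde_coefficient[OF l]]) simp
  next
    show "(\<forall>\<^sub>F r in at_right 0. only_singularity (\<lambda>\<xi>. \<xi> ^ (n + m - 1) / (\<xi> - 1) ^ (m + 1) *
               (1 / (1 - ?y m * \<xi> powr ?a) ^ j)) 1 r) \<and>
        (\<forall>r. only_singularity (\<lambda>\<xi>. \<xi> ^ (n + m - 1) / (\<xi> - 1) ^ (m + 1) *
               (1 / (1 - ?y m * \<xi> powr ?a) ^ j)) 1 r \<longrightarrow>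
          complex_of_real (phi_cond M X \<alpha> lam \<beta> n m j ns) =
            of_real ((1 - y_seq \<alpha> lam \<beta> m) ^ j / real ((n + m - 1) choose m)) *
            (1 / (2 * of_real pi * \<i>)) * contour_integral (circlepath 1 r) (\<lambda>\<xi>. \<xi> ^ (n + m - 1) / (\<xi> - 1) ^ (m + 1) *
               (1 / (1 - ?y m * \<xi> powr ?a) ^ j)))"
    proof (rule contour_formula[OF y_expansion[of "n + m - 1" m j]])
      show "complex_of_real (phi_cond M X \<alpha> lam \<beta> n m j ns) =
        of_real ((1 - y_seq \<alpha> lam \<beta> m) ^ j / real ((n + m - 1) choose m)) *
        fps_nth (fps_binomial (of_nat (n + m - 1)) * inverse (1 - fps_const (?y m) * fps_binomial ?a) ^ j) m"
        by (rule phi_cond_coefficient[where \<beta> = \<beta> and m = m, OF model n beta_pos[OF m] ns])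
    qed (simp add: power_one_over)
  next
    show "(\<forall>\<^sub>F r in at_right 0. only_singularity (\<lambda>\<xi>. \<xi> ^ (n + m - 1) /
               ((\<xi> - 1) ^ (m + 1) * (1 - ?yl m * \<xi> powr ?al * (\<xi> - 1) ^ l) ^ j)) 1 r) \<and>
        (\<forall>r. only_singularity (\<lambda>\<xi>. \<xi> ^ (n + m - 1) /
               ((\<xi> - 1) ^ (m + 1) * (1 - ?yl m * \<xi> powr ?al * (\<xi> - 1) ^ l) ^ j)) 1 r \<longrightarrow>
          complex_of_real (phi_cond_freq M X \<alpha> lam \<beta> l n m j ns) =
            of_real (fact m / pochhammer (real n) m) *
            (1 / (2 * of_real pi * \<i>)) * contour_integral (circlepath 1 r) (\<lambda>\<xi>. \<xi> ^ (n + m - 1) /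
               ((\<xi> - 1) ^ (m + 1) * (1 - ?yl m * \<xi> powr ?al * (\<xi> - 1) ^ l) ^ j)))"
    proof (rule contour_formula[OF yl_expansion[of "n + m - 1" m j]])
      show "complex_of_real (phi_cond_freq M X \<alpha> lam \<beta> l n m j ns) =
        of_real (fact m / pochhammer (real n) m) *
        fps_nth (fps_binomial (of_nat (n + m - 1)) *
          inverse (1 - fps_const (?yl m) * fps_binomial ?al * fps_X ^ l) ^ j) m"
        by (rule phi_cond_freq_coefficient[where \<beta> = \<beta> and m = m, OF model l n beta_pos[OF m] ns])
    qed (simp add: power_one_over)
  qed
qed

end
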